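(* Let $p$ be an odd prime and let $G$ be a non-abelian group of order $p^5$. Then $\mathrm{Aut}_c(G)=\mathrm{Aut}_z(G)$ if and only if $G$ belongs to the isoclinism family $\Phi_5$.
   Context: $\mathrm{Aut}_c(G)$ is the group of all class preserving automorphisms of $G$, i.e. automorphisms $\alpha$ such that $\alpha(x)$ is conjugate to $x$ in $G$ for every $x\in G$. $\mathrm{Aut}_z(G)$ is the group of all central automorphisms of $G$, i.e. automorphisms $\phi$ such that $g^{-1}\phi(g)\in Z(G)$ for every $g\in G$. Commutators are $[x,y]=x^{-1}y^{-1}xy$ and $\gamma_2(G)$ is the commutator subgroup. Two groups $G,H$ are isoclinic if there are isomorphisms $\theta:G/Z(G)\to H/Z(H)$ and $\varphi:\gamma_2(G)\to\gamma_2(H)$ such that $\varphi([a,b])=[a',b']$ whenever $a'Z(H)=\theta(aZ(G))$ and $b'Z(H)=\theta(bZ(G))$. $\Phi_5$ (in the numbering of James' classification of groups of order $p^n$, $n\le 6$, $p$ odd) is the isoclinism family consisting of all groups isoclinic to the extraspecial group of order $p^5$ $$\langle \alpha_1,\alpha_2,\alpha_3,\alpha_4,\beta \mid [\alpha_1,\alpha_2]=[\alpha_3,\alpha_4]=\beta,\ \alpha_i^p=\beta^p=1\ (1\le i\le 4)\rangle,$$ where all commutators of pairs of generators not listed (other than inverses of listed ones) are trivial. *)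

theory Defs
  imports "HOL-Algebra.Algebra" "HOL-Computational_Algebra.Primes"
begin

definition group_commutator :: "('a, 'b) monoid_scheme \<Rightarrow> 'a \<Rightarrow> 'a \<Rightarrow> 'a" where
  "group_commutator G x y = inv\<^bsub>G\<^esub> x \<otimes>\<^bsub>G\<^esub> inv\<^bsub>G\<^esub> y \<otimes>\<^bsub>G\<^esub> x \<otimes>\<^bsub>G\<^esub> y"

definition group_center :: "('a, 'b) monoid_scheme \<Rightarrow> 'a set" where
  "group_center G = {z \<in> carrier G. \<forall>g \<in> carrier G. z \<otimes>\<^bsub>G\<^esub> g = g \<otimes>\<^bsub>G\<^esub> z}"

definition conjugate_in :: "('a, 'b) monoid_scheme \<Rightarrow> 'a \<Rightarrow> 'a \<Rightarrow> bool" where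
  "conjugate_in G x y \<longleftrightarrow> (\<exists>g \<in> carrier G. y = inv\<^bsub>G\<^esub> g \<otimes>\<^bsub>G\<^esub> x \<otimes>\<^bsub>G\<^esub> g)"

text \<open>
  Automorphisms are taken from the carrier \<open>auto G\<close> of the library's automorphism group
  \<open>AutoGroup G\<close>; they are extensional, so equality of automorphisms is equality of functions.
  The two subsets below are subgroups of \<open>AutoGroup G\<close> and are hence equal as groups iff they are
  equal as sets.
\<close>

definition class_preserving_auto :: "('a, 'b) monoid_scheme \<Rightarrow> ('a \<Rightarrow> 'a) set" where
  "class_preserving_auto G = {\<alpha> \<in> auto G. \<forall>x \<in> carrier G. conjugate_in G x (\<alpha> x)}"

definition central_auto :: "('a, 'b) monoid_scheme \<Rightarrow> ('a \<Rightarrow> 'a) set" where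
  "central_auto G = {\<phi> \<in> auto G. \<forall>g \<in> carrier G. inv\<^bsub>G\<^esub> g \<otimes>\<^bsub>G\<^esub> \<phi> g \<in> group_center G}"


section \<open>Isoclinism\<close>

text \<open>
  The commutator subgroup is the library's \<open>derived G (carrier G)\<close>. The library generates it by the
  elements \<open>x y x\<inverse> y\<inverse>\<close>, which are the commutators of \<open>x\<inverse>\<close> and \<open>y\<inverse>\<close> in the
  convention of \<open>group_commutator\<close>; the subgroup is the same. Elements of \<open>G Mod N\<close> are
  right cosets, which for the centre coincide with the left ones.
\<close>

definition commutator_subgroup :: "('a, 'b) monoid_scheme \<Rightarrow> ('a, 'b) monoid_scheme" where
  "commutator_subgroup G = G\<lparr>carrier := derived G (carrier G)\<rparr>"

definition isoclinic :: "('a, 'b) monoid_scheme \<Rightarrow> ('c, 'd) monoid_scheme \<Rightarrow> bool" where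
  "isoclinic G H \<longleftrightarrow>
     (\<exists>\<theta> \<in> iso (G Mod group_center G) (H Mod group_center H).
      \<exists>\<phi> \<in> iso (commutator_subgroup G) (commutator_subgroup H).
        \<forall>a \<in> carrier G. \<forall>b \<in> carrier G. \<forall>a' \<in> carrier H. \<forall>b' \<in> carrier H.
          group_center H #>\<^bsub>H\<^esub> a' = \<theta> (group_center G #>\<^bsub>G\<^esub> a) \<longrightarrow>
          group_center H #>\<^bsub>H\<^esub> b' = \<theta> (group_center G #>\<^bsub>G\<^esub> b) \<longrightarrow>
          \<phi> (group_commutator G a b) = group_commutator H a' b')"


section \<open>Groups given by generators and relators\<close>

text \<open>
  A word over the generators \<open>'g\<close> is a list of letters; \<open>(x, True)\<close> stands for \<open>x\<close> and
  \<open>(x, False)\<close> for \<open>x\<inverse>\<close>. The group \<open>\<langle>'g | R\<rangle>\<close> consists of the words modulo the least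
  congruence of the word monoid that contains free cancellation and identifies every relator
  with the empty word.
\<close>

type_synonym 'g word = "('g \<times> bool) list"

definition gen_word :: "'g \<Rightarrow> 'g word" where
  "gen_word x = [(x, True)]"

definition inv_word :: "'g word \<Rightarrow> 'g word" where
  "inv_word w = rev (map (\<lambda>(x, b). (x, \<not> b)) w)"

definition pow_word :: "'g word \<Rightarrow> nat \<Rightarrow> 'g word" where
  "pow_word w n = concat (replicate n w)"

definition comm_word :: "'g word \<Rightarrow> 'g word \<Rightarrow> 'g word" where
  "comm_word u v = inv_word u @ inv_word v @ u @ v"

inductive word_cong :: "'g word set \<Rightarrow> 'g word \<Rightarrow> 'g word \<Rightarrow> bool" for R where
  refl: "word_cong R w w"
| sym: "word_cong R u v \<Longrightarrow> word_cong R v u"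
| trans: "word_cong R u v \<Longrightarrow> word_cong R v w \<Longrightarrow> word_cong R u w"
| append: "word_cong R u u' \<Longrightarrow> word_cong R v v' \<Longrightarrow> word_cong R (u @ v) (u' @ v')"
| cancel: "word_cong R [(x, b), (x, \<not> b)] []"
| relator: "r \<in> R \<Longrightarrow> word_cong R r []"

definition word_rel :: "'g word set \<Rightarrow> ('g word \<times> 'g word) set" where
  "word_rel R = {(u, v). word_cong R u v}"

definition presented_group :: "'g word set \<Rightarrow> 'g word set monoid" where
  "presented_group R =
     \<lparr>carrier = UNIV // word_rel R,
      monoid.mult = (\<lambda>A B. \<Union>u \<in> A. \<Union>v \<in> B. word_rel R `` {u @ v}),
      one = word_rel R `` {[]}\<rparr>"


section \<open>The extraspecial group and the family \<open>\<Phi>\<^sub>5\<close>\<close>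

datatype phi5_gen = Alpha1 | Alpha2 | Alpha3 | Alpha4 | Beta

text \<open>
  A relation \<open>u = v\<close> is encoded by the relator \<open>u v\<inverse>\<close>. The last set contains the commutators of
  all remaining pairs of generators, in particular of all pairs involving \<open>\<beta>\<close>.
\<close>

definition phi5_relators :: "nat \<Rightarrow> phi5_gen word set" where
  "phi5_relators p =
     {comm_word (gen_word Alpha1) (gen_word Alpha2) @ inv_word (gen_word Beta),
      comm_word (gen_word Alpha3) (gen_word Alpha4) @ inv_word (gen_word Beta)} \<union>
     {pow_word (gen_word x) p | x. x \<in> {Alpha1, Alpha2, Alpha3, Alpha4, Beta}} \<union>
     {comm_word (gen_word x) (gen_word y) | x y.
        (x, y) \<notin> {(Alpha1, Alpha2), (Alpha2, Alpha1), (Alpha3, Alpha4), (Alpha4, Alpha3)}}"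

definition extraspecial_phi5 :: "nat \<Rightarrow> phi5_gen word set monoid" where
  "extraspecial_phi5 p = presented_group (phi5_relators p)"

definition in_phi5 :: "nat \<Rightarrow> ('a, 'b) monoid_scheme \<Rightarrow> bool" where
  "in_phi5 p G \<longleftrightarrow> group G \<and> isoclinic G (extraspecial_phi5 p)"


section \<open>Well-definedness\<close>

lemma equiv_word_rel: "equiv UNIV (word_rel R)"
  unfolding word_rel_def
  by (rule equivI)
    (auto simp: refl_on_def sym_def trans_def intro: word_cong.refl word_cong.sym word_cong.trans)

lemma word_class_eq_iff: "word_rel R `` {u} = word_rel R `` {v} \<longleftrightarrow> word_cong R u v"
  using eq_equiv_class_iff[OF equiv_word_rel, of u v R] by (simp add: word_rel_def)

lemma presented_group_mult:
  "word_rel R `` {u} \<otimes>\<^bsub>presented_group R\<^esub> word_rel R `` {v} = word_rel R `` {u @ v}"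
  using word_cong.refl[of R u] word_cong.refl[of R v]
  by (auto simp: presented_group_def word_rel_def intro: word_cong.append word_cong.trans)

lemma word_cong_inv_left: "word_cong R (inv_word w @ w) []"
proof (induction w)
  case Nil
  show ?case by (simp add: inv_word_def word_cong.refl)
next
  case (Cons a w)
  obtain x b where a: "a = (x, b)" by (cases a)
  have "word_cong R ([(x, \<not> b), (x, b)] @ w) ([] @ w)"
    using word_cong.cancel[of R x "\<not> b"] by (intro word_cong.append word_cong.refl) simp
  then have "word_cong R (inv_word w @ ([(x, \<not> b), (x, b)] @ w)) (inv_word w @ w)"
    by (intro word_cong.append word_cong.refl) simp
  then show ?case
    using Cons.IH by (auto simp: a inv_word_def intro: word_cong.trans)
qed

lemma presented_group_is_group: "group (presented_group R)"
proof -
  have c: "carrier (presented_group R) = range (\<lambda>w. word_rel R `` {w})"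
    by (auto simp: presented_group_def quotient_def)
  have o: "\<one>\<^bsub>presented_group R\<^esub> = word_rel R `` {[]}"
    by (simp add: presented_group_def)
  show ?thesis
  proof (rule groupI)
    fix x assume "x \<in> carrier (presented_group R)"
    then obtain w where w: "x = word_rel R `` {w}" by (auto simp: c)
    have "word_rel R `` {inv_word w} \<otimes>\<^bsub>presented_group R\<^esub> x = \<one>\<^bsub>presented_group R\<^esub>"
      by (simp add: w o presented_group_mult word_class_eq_iff word_cong_inv_left)
    then show "\<exists>y\<in>carrier (presented_group R). y \<otimes>\<^bsub>presented_group R\<^esub> x = \<one>\<^bsub>presented_group R\<^esub>"
      by (auto simp: c)
  qed (auto simp: c o presented_group_mult)
qed

lemma (in group) group_center_normal: "group_center G \<lhd> G"
proof -
  have sub: "subgroup (group_center G) G"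
  proof (rule subgroupI)
    show "group_center G \<noteq> {}" by (auto simp: group_center_def intro!: exI[of _ \<one>])
  next
    fix a assume a: "a \<in> group_center G"
    then have [simp]: "a \<in> carrier G" by (simp add: group_center_def)
    have "inv a \<otimes> g = g \<otimes> inv a" if g: "g \<in> carrier G" for g
    proof -
      have "inv a \<otimes> g = inv (inv g \<otimes> a)" using g by (simp add: inv_mult_group)
      also have "inv g \<otimes> a = a \<otimes> inv g" using a g by (simp add: group_center_def)
      finally show ?thesis using g by (simp add: inv_mult_group)
    qed
    then show "inv a \<in> group_center G" by (simp add: group_center_def)
  next
    fix a b assume a: "a \<in> group_center G" and b: "b \<in> group_center G"
    then have ac [simp]: "a \<in> carrier G" "b \<in> carrier G" by (simp_all add: group_center_def)
    have "a \<otimes> b \<otimes> g = g \<otimes> (a \<otimes> b)" if g: "g \<in> carrier G" for g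
    proof -
      have ag: "a \<otimes> g = g \<otimes> a" "b \<otimes> g = g \<otimes> b" using a b g by (simp_all add: group_center_def)
      have "a \<otimes> b \<otimes> g = a \<otimes> g \<otimes> b" using g by (simp add: m_assoc ag(2))
      also have "\<dots> = g \<otimes> a \<otimes> b" by (simp add: ag(1))
      finally show ?thesis using g by (simp add: m_assoc)
    qed
    then show "a \<otimes> b \<in> group_center G" by (simp add: group_center_def)
  qed (auto simp: group_center_def)
  have "g \<otimes> z \<otimes> inv g \<in> group_center G" if g: "g \<in> carrier G" and z: "z \<in> group_center G" for g z
  proof -
    have zc: "z \<in> carrier G" and gz: "g \<otimes> z = z \<otimes> g" using z g by (simp_all add: group_center_def)
    have "g \<otimes> z \<otimes> inv g = z" unfolding gz using g zc by (simp add: m_assoc)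
    with z show ?thesis by simp
  qed
  with sub show ?thesis by (simp add: normal_inv_iff)
qed

lemma (in group) group_autoI:
  assumes "A \<subseteq> auto G" "(\<lambda>x \<in> carrier G. x) \<in> A"
    and "\<And>f g. f \<in> A \<Longrightarrow> g \<in> A \<Longrightarrow> compose (carrier G) f g \<in> A"
    and "\<And>f. f \<in> A \<Longrightarrow> restrict (inv_into (carrier G) f) (carrier G) \<in> A"
  shows "subgroup A (AutoGroup G)"
proof -
  have "subgroup A (BijGroup (carrier G))"
  proof (rule group.subgroupI[OF group_BijGroup])
    fix f assume "f \<in> A"
    then show "inv\<^bsub>BijGroup (carrier G)\<^esub> f \<in> A"
      using assms(1,4) by (subst inv_BijGroup) (auto simp: auto_def)
  next
    fix f g assume "f \<in> A" "g \<in> A"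
    then show "f \<otimes>\<^bsub>BijGroup (carrier G)\<^esub> g \<in> A"
      using assms(1,3) by (auto simp: BijGroup_def auto_def)
  qed (use assms(1,2) in \<open>auto simp: BijGroup_def auto_def\<close>)
  then show ?thesis
    unfolding AutoGroup_def using assms(1) group.subgroup_incl[OF group_BijGroup _ subgroup_auto]
    by blast
qed

lemma autoD:
  assumes "f \<in> auto G"
  shows "x \<in> carrier G \<Longrightarrow> f x \<in> carrier G"
    and "x \<in> carrier G \<Longrightarrow> y \<in> carrier G \<Longrightarrow> f (x \<otimes>\<^bsub>G\<^esub> y) = f x \<otimes>\<^bsub>G\<^esub> f y"
    and "x \<in> carrier G \<Longrightarrow> inv_into (carrier G) f x \<in> carrier G"
    and "x \<in> carrier G \<Longrightarrow> f (inv_into (carrier G) f x) = x"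
  using assms by (auto simp: auto_def hom_def Bij_def bij_betw_def inv_into_into f_inv_into_f)

lemma (in group) compose_in_auto:
  "f \<in> auto G \<Longrightarrow> g \<in> auto G \<Longrightarrow> compose (carrier G) f g \<in> auto G"
  using subgroup.m_closed[OF subgroup_auto, of f g] by (auto simp: BijGroup_def auto_def)

lemma (in group) inv_in_auto:
  "f \<in> auto G \<Longrightarrow> restrict (inv_into (carrier G) f) (carrier G) \<in> auto G"
  using subgroup.m_inv_closed[OF subgroup_auto, of f] inv_BijGroup[of f "carrier G"]
  by (auto simp: auto_def)

lemma (in group) cancel_inv: "x \<in> carrier G \<Longrightarrow> y \<in> carrier G \<Longrightarrow> x \<otimes> (inv x \<otimes> y) = y"
  by (simp flip: m_assoc)

lemma (in group) conjugate_in_sym: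
  assumes "x \<in> carrier G" "conjugate_in G x y"
  shows "conjugate_in G y x"
proof -
  obtain g where g: "g \<in> carrier G" "y = inv g \<otimes> x \<otimes> g"
    using assms by (auto simp: conjugate_in_def)
  have "x = inv (inv g) \<otimes> y \<otimes> inv g"
    using g assms(1) by (simp add: m_assoc cancel_inv)
  with g show ?thesis unfolding conjugate_in_def by blast
qed

lemma (in group) conjugate_in_trans:
  assumes "x \<in> carrier G" "conjugate_in G x y" "conjugate_in G y z"
  shows "conjugate_in G x z"
proof -
  obtain g h where gh: "g \<in> carrier G" "y = inv g \<otimes> x \<otimes> g" "h \<in> carrier G" "z = inv h \<otimes> y \<otimes> h"
    using assms by (auto simp: conjugate_in_def)
  then have "z = inv (g \<otimes> h) \<otimes> x \<otimes> (g \<otimes> h)"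
    using assms(1) by (simp add: m_assoc inv_mult_group)
  with gh show ?thesis unfolding conjugate_in_def by blast
qed

lemma (in group) class_preserving_auto_subgroup: "subgroup (class_preserving_auto G) (AutoGroup G)"
proof (rule group_autoI)
  show "(\<lambda>x \<in> carrier G. x) \<in> class_preserving_auto G"
    by (auto simp: class_preserving_auto_def id_in_auto conjugate_in_def intro!: bexI[of _ \<one>])
next
  fix f g assume "f \<in> class_preserving_auto G" "g \<in> class_preserving_auto G"
  then show "compose (carrier G) f g \<in> class_preserving_auto G"
    by (auto simp: class_preserving_auto_def compose_in_auto compose_eq autoD
        intro: conjugate_in_trans)
next
  fix f assume f: "f \<in> class_preserving_auto G"
  have "conjugate_in G x (inv_into (carrier G) f x)" if "x \<in> carrier G" for x
  proof -
    have fa: "f \<in> auto G" using f by (simp add: class_preserving_auto_def)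
    have "conjugate_in G (inv_into (carrier G) f x) (f (inv_into (carrier G) f x))"
      using f autoD(3)[OF fa that] by (simp add: class_preserving_auto_def)
    then show ?thesis
      using conjugate_in_sym autoD(3,4)[OF fa that] by metis
  qed
  with f show "restrict (inv_into (carrier G) f) (carrier G) \<in> class_preserving_auto G"
    by (auto simp: class_preserving_auto_def inv_in_auto)
qed (auto simp: class_preserving_auto_def)

lemma (in group) central_auto_subgroup: "subgroup (central_auto G) (AutoGroup G)"
proof (rule group_autoI)
  interpret Z: normal "group_center G" G by (rule group_center_normal)
  show "(\<lambda>x \<in> carrier G. x) \<in> central_auto G"
    by (auto simp: central_auto_def id_in_auto)
  {
    fix f g assume fg: "f \<in> central_auto G" "g \<in> central_auto G"
    have "inv x \<otimes> f (g x) \<in> group_center G" if x: "x \<in> carrier G" for x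
    proof -
      have gx: "g x \<in> carrier G" and fgx: "f (g x) \<in> carrier G"
        using fg x by (auto simp: central_auto_def autoD)
      have "inv x \<otimes> f (g x) = (inv x \<otimes> g x) \<otimes> (inv (g x) \<otimes> f (g x))"
        using x gx fgx by (simp add: m_assoc cancel_inv)
      then show ?thesis using fg x gx by (auto simp: central_auto_def)
    qed
    with fg show "compose (carrier G) f g \<in> central_auto G"
      by (auto simp: central_auto_def compose_in_auto compose_eq)
  }
  fix f assume f: "f \<in> central_auto G"
  have "inv x \<otimes> inv_into (carrier G) f x \<in> group_center G" if x: "x \<in> carrier G" for x
  proof -
    have fa: "f \<in> auto G" using f by (simp add: central_auto_def)
    define y where "y = inv_into (carrier G) f x"
    have y: "y \<in> carrier G" "f y = x" using autoD(3,4)[OF fa x] by (simp_all add: y_def)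
    interpret Z: normal "group_center G" G by (rule group_center_normal)
    have "inv (inv y \<otimes> f y) \<in> group_center G" using f y by (auto simp: central_auto_def)
    then show ?thesis using y x by (simp add: inv_mult_group flip: y_def)
  qed
  with f show "restrict (inv_into (carrier G) f) (carrier G) \<in> central_auto G"
    by (auto simp: central_auto_def inv_in_auto)
qed (auto simp: central_auto_def)

end

theory Submission
  imports Defs
begin

text \<open>
  If all inner automorphisms are central, then \<open>G\<close> has class at most two, and every homomorphism
  \<open>f\<close> from \<open>G/Z(G)\<close> to \<open>Z(G)\<close> gives a central automorphism \<open>x \<mapsto> x f(x)\<close>. If these are class
  preserving, then every noncentral \<open>g\<close> satisfies \<open>[g, G] = Z(G)\<close>; as an alternating form on a
  space of dimension three is degenerate, this forces \<open>|Z(G)| = p\<close>, so \<open>G\<close> is extraspecial.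
  A symplectic basis of \<open>G/Z(G)\<close> then presents \<open>G\<close>, just like the group with the given
  presentation, as a quotient of the integral Heisenberg group, and two such quotients are isoclinic.
  Conversely, if \<open>G\<close> belongs to the family, then \<open>Z(G) = \<gamma>\<^sub>2(G)\<close> has order \<open>p\<close> and the conjugacy
  class of a noncentral \<open>x\<close> is the whole coset \<open>x Z(G)\<close>.
\<close>

section \<open>Commutator calculus\<close>

text \<open>The forward implication needs homomorphisms from \<open>G/Z(G)\<close> to
  \<open>Z(G)\<close> with a prescribed value at a prescribed element, so the exponents of both
  groups must be shown to divide \<open>p\<close> beforehand. For the quotient this is a counting
  argument; for the centre the map \<open>x \<mapsto> x^p\<close> is itself fed into the hypothesis
  on central automorphisms, and this is where \<open>p\<close> odd enters. Isoclinism rather than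
  isomorphism is reached because the p-th powers of a symplectic basis are known to be central but
  nothing more. A cover by a group that imposes no relation on powers absorbs this: whether the
  image of a tuple is central, and whether \<open>(0, 0, 0, 0, k)\<close> maps to the identity,
  depend on \<open>p\<close> alone. These two conditions determine both isomorphisms of an
  isoclinism, so neither has to be written down on cosets or on commutator subgroups.\<close>

lemma int_eq_of_dvd_diff:
  fixes u v :: int
  assumes "u \<in> {0..<n}" "v \<in> {0..<n}" "n dvd u - v"
  shows "u = v"
proof -
  have "u mod n = v mod n" using assms(3) by (simp add: mod_eq_dvd_iff)
  with assms(1,2) show ?thesis by simp
qed

context group
begin

lemma cancel_inv_left: "x \<in> carrier G \<Longrightarrow> y \<in> carrier G \<Longrightarrow> inv x \<otimes> (x \<otimes> y) = y"
  by (simp flip: m_assoc)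

text \<open>With these rules \<open>simp\<close> brings products to a right-associated, freely
  reduced form, which decides identities that hold in free groups.\<close>

lemmas free_simps = m_assoc cancel_inv cancel_inv_left inv_mult_group

lemma group_commutator_closed [simp]:
  "x \<in> carrier G \<Longrightarrow> y \<in> carrier G \<Longrightarrow> group_commutator G x y \<in> carrier G"
  by (simp add: group_commutator_def)

lemma center_closed: "z \<in> group_center G \<Longrightarrow> z \<in> carrier G"
  by (simp add: group_center_def)

lemma center_commute: "z \<in> group_center G \<Longrightarrow> g \<in> carrier G \<Longrightarrow> z \<otimes> g = g \<otimes> z"
  by (simp add: group_center_def)

lemma group_center_subgroup: "subgroup (group_center G) G"
  using group_center_normal by (rule normal_imp_subgroup)

lemma swap_commutator:
  "x \<in> carrier G \<Longrightarrow> y \<in> carrier G \<Longrightarrow> x \<otimes> y = y \<otimes> x \<otimes> group_commutator G x y"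
  by (simp add: group_commutator_def free_simps)

lemma group_commutator_eq_one_iff:
  assumes "x \<in> carrier G" "y \<in> carrier G"
  shows "group_commutator G x y = \<one> \<longleftrightarrow> x \<otimes> y = y \<otimes> x"
  using assms swap_commutator[of x y] by (simp add: r_cancel_one')

lemma inv_group_commutator:
  "x \<in> carrier G \<Longrightarrow> y \<in> carrier G \<Longrightarrow> inv (group_commutator G x y) = group_commutator G y x"
  by (simp add: group_commutator_def free_simps)

lemma center_iff_commutator:
  assumes "x \<in> carrier G"
  shows "x \<in> group_center G \<longleftrightarrow> (\<forall>y \<in> carrier G. group_commutator G x y = \<one>)"
  using assms by (auto simp: group_center_def group_commutator_eq_one_iff)

text \<open>The conjugacy class of \<open>x\<close> is therefore \<open>x [x, G]\<close>, which
  turns class preservation into a question about commutators.\<close>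

lemma conjugate_eq_commutator:
  "x \<in> carrier G \<Longrightarrow> g \<in> carrier G \<Longrightarrow> inv g \<otimes> x \<otimes> g = x \<otimes> group_commutator G x g"
  by (simp add: group_commutator_def free_simps)

end

text \<open>Nilpotency class at most two; abelian groups are included.\<close>

locale class_two_group = group +
  assumes commutator_central:
    "x \<in> carrier G \<Longrightarrow> y \<in> carrier G \<Longrightarrow> group_commutator G x y \<in> group_center G"
begin

text \<open>In every group \<open>[x y, z]\<close> is \<open>[x, z]\<close> conjugated by
  \<open>y\<close>, times \<open>[y, z]\<close>; the conjugation has no effect on a central
  commutator.\<close>

lemma commutator_hom_left:
  assumes z: "z \<in> carrier G"
  shows "(\<lambda>x. group_commutator G x z) \<in> hom G G"
proof (rule homI)
  fix x y assume xy: "x \<in> carrier G" "y \<in> carrier G"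
  have "group_commutator G (x \<otimes> y) z
      = inv y \<otimes> (group_commutator G x z \<otimes> (inv z \<otimes> y \<otimes> z))"
    using xy z by (simp add: group_commutator_def free_simps)
  also have "\<dots> = inv y \<otimes> ((inv z \<otimes> y \<otimes> z) \<otimes> group_commutator G x z)"
    using xy z center_commute[OF commutator_central, of x z "inv z \<otimes> y \<otimes> z"] by simp
  also have "\<dots> = group_commutator G y z \<otimes> group_commutator G x z"
    using xy z by (simp add: group_commutator_def free_simps)
  also have "\<dots> = group_commutator G x z \<otimes> group_commutator G y z"
    using xy z by (simp add: center_commute commutator_central)
  finally show "group_commutator G (x \<otimes> y) z = \<dots>" .
qed (use z in simp)

lemma commutator_hom_right:
  assumes z: "z \<in> carrier G"
  shows "group_commutator G z \<in> hom G G"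
proof (rule homI)
  fix x y assume xy: "x \<in> carrier G" "y \<in> carrier G"
  have "group_commutator G z (x \<otimes> y) = inv (group_commutator G (x \<otimes> y) z)"
    using xy z by (simp add: inv_group_commutator)
  also have "\<dots> = inv (group_commutator G x z \<otimes> group_commutator G y z)"
    using xy z commutator_hom_left[OF z] by (simp add: hom_def)
  also have "\<dots> = inv (group_commutator G y z \<otimes> group_commutator G x z)"
    using xy z by (simp add: center_commute commutator_central)
  also have "\<dots> = group_commutator G z x \<otimes> group_commutator G z y"
    using xy z by (simp add: inv_mult_group inv_group_commutator)
  finally show "group_commutator G z (x \<otimes> y) = \<dots>" .
qed (use z in simp)

lemma commutator_mult_left:
  "x \<in> carrier G \<Longrightarrow> y \<in> carrier G \<Longrightarrow> z \<in> carrier G \<Longrightarrow>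
    group_commutator G (x \<otimes> y) z = group_commutator G x z \<otimes> group_commutator G y z"
  using commutator_hom_left[of z] by (simp add: hom_def)

lemma commutator_mult_right:
  "x \<in> carrier G \<Longrightarrow> y \<in> carrier G \<Longrightarrow> z \<in> carrier G \<Longrightarrow>
    group_commutator G z (x \<otimes> y) = group_commutator G z x \<otimes> group_commutator G z y"
  using commutator_hom_right[of z] by (simp add: hom_def)

lemma commutator_int_pow_left:
  "x \<in> carrier G \<Longrightarrow> z \<in> carrier G \<Longrightarrow>
    group_commutator G (x [^] (n::int)) z = group_commutator G x z [^] n"
  using hom_int_pow[OF commutator_hom_left] group_axioms by blast

lemma commutator_int_pow_right:
  "x \<in> carrier G \<Longrightarrow> z \<in> carrier G \<Longrightarrow>
    group_commutator G z (x [^] (n::int)) = group_commutator G z x [^] n"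
  using hom_int_pow[OF commutator_hom_right] group_axioms by blast

lemma commutator_center_left:
  "z \<in> group_center G \<Longrightarrow> x \<in> carrier G \<Longrightarrow> group_commutator G z x = \<one>"
  by (simp add: group_commutator_eq_one_iff center_commute center_closed)

lemma commutator_center_right:
  "z \<in> group_center G \<Longrightarrow> x \<in> carrier G \<Longrightarrow> group_commutator G x z = \<one>"
  by (simp add: group_commutator_eq_one_iff center_commute center_closed)

lemma commutator_self: "x \<in> carrier G \<Longrightarrow> group_commutator G x x = \<one>"
  by (simp add: group_commutator_eq_one_iff)

text \<open>Collecting the factors \<open>x\<close> on the left moves each of them past the factors
  \<open>y\<close> before it, with one central commutator per exchange and
  \<open>n (n - 1) / 2\<close> exchanges in all.\<close>

lemma power_mult_class_two:
  assumes x: "x \<in> carrier G" and y: "y \<in> carrier G"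
  shows "(x \<otimes> y) [^] (n::nat) = x [^] n \<otimes> y [^] n \<otimes> group_commutator G y x [^] (n * (n - 1) div 2)"
proof (induction n)
  case (Suc n)
  let ?c = "group_commutator G y x"
  have cZ: "?c [^] k \<in> group_center G" for k :: nat
    using subgroup_int_pow_closed[OF group_center_subgroup commutator_central[OF y x], of "int k"]
    by (simp only: int_pow_int)
  have c: "?c \<in> carrier G" "?c \<in> group_center G" by (simp_all add: x y commutator_central)
  have swap: "y [^] n \<otimes> x = x \<otimes> y [^] n \<otimes> ?c [^] n"
    using swap_commutator[of "y [^] n" x] commutator_int_pow_left[of y x "int n"] x y
    by (simp add: int_pow_int)
  have "(x \<otimes> y) [^] Suc n = x [^] n \<otimes> y [^] n \<otimes> (?c [^] (n * (n - 1) div 2) \<otimes> (x \<otimes> y))"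
    using Suc.IH x y by (simp add: m_assoc)
  also have "\<dots> = x [^] n \<otimes> (y [^] n \<otimes> x) \<otimes> (y \<otimes> ?c [^] (n * (n - 1) div 2))"
    using center_commute[OF cZ, of "x \<otimes> y" "n * (n - 1) div 2"] x y by (simp add: m_assoc)
  also have "\<dots> = x [^] n \<otimes> x \<otimes> y [^] n \<otimes> (?c [^] n \<otimes> y) \<otimes> ?c [^] (n * (n - 1) div 2)"
    unfolding swap using x y by (simp add: m_assoc)
  also have "?c [^] n \<otimes> y = y \<otimes> ?c [^] n"
    using center_commute[OF cZ y] .
  also have "x [^] n \<otimes> x \<otimes> y [^] n \<otimes> (y \<otimes> ?c [^] n) \<otimes> ?c [^] (n * (n - 1) div 2)
      = x [^] Suc n \<otimes> y [^] Suc n \<otimes> ?c [^] (n + n * (n - 1) div 2)"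
    using x y c by (simp add: m_assoc flip: nat_pow_mult)
  also have "n + n * (n - 1) div 2 = Suc n * (Suc n - 1) div 2"
    by (cases n) (simp_all add: algebra_simps)
  finally show ?case .
qed simp

end

section \<open>Isoclinism from a common cover\<close>

lemma (in group) mult_inv_eq_one_iff:
  "x \<in> carrier G \<Longrightarrow> y \<in> carrier G \<Longrightarrow> x \<otimes> inv y = \<one> \<longleftrightarrow> x = y"
  by (metis inv_equality inv_inv inv_closed r_inv)

text \<open>Both targets are the quotient of \<open>A\<close> by the same kernel. Choosing a
  preimage under \<open>f\<close> and applying \<open>g\<close> avoids that quotient.\<close>

lemma iso_of_common_source:
  assumes A: "group A" and K: "group K" and L: "group L"
    and f: "f \<in> hom A K" "f ` carrier A = carrier K"
    and g: "g \<in> hom A L" "g ` carrier A = carrier L"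
    and ker: "\<And>a. a \<in> carrier A \<Longrightarrow> f a = \<one>\<^bsub>K\<^esub> \<longleftrightarrow> g a = \<one>\<^bsub>L\<^esub>"
  obtains \<theta> where "\<theta> \<in> iso K L" "\<And>a. a \<in> carrier A \<Longrightarrow> \<theta> (f a) = g a"
proof -
  interpret f: group_hom A K f using A K f by (simp add: group_hom_def group_hom_axioms_def)
  interpret g: group_hom A L g using A L g by (simp add: group_hom_def group_hom_axioms_def)
  have eq: "f a = f b \<longleftrightarrow> g a = g b" if "a \<in> carrier A" "b \<in> carrier A" for a b
    using ker[of "a \<otimes>\<^bsub>A\<^esub> inv\<^bsub>A\<^esub> b"] that
    by (simp add: f.H.mult_inv_eq_one_iff g.H.mult_inv_eq_one_iff)
  define \<theta> where "\<theta> x = g (inv_into (carrier A) f x)" for x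
  have \<theta>: "\<theta> (f a) = g a" if a: "a \<in> carrier A" for a
  proof -
    have "inv_into (carrier A) f (f a) \<in> carrier A" "f (inv_into (carrier A) f (f a)) = f a"
      using a by (simp_all add: inv_into_into f_inv_into_f)
    then show ?thesis using eq a unfolding \<theta>_def by blast
  qed
  have "\<theta> \<in> hom K L"
  proof (rule homI)
    fix x assume "x \<in> carrier K"
    then obtain a where "a \<in> carrier A" "x = f a" using f(2) by (metis imageE)
    then show "\<theta> x \<in> carrier L" by (simp add: \<theta>)
  next
    fix x y assume "x \<in> carrier K" "y \<in> carrier K"
    then obtain a b where ab: "a \<in> carrier A" "b \<in> carrier A" "x = f a" "y = f b"
      using f(2) by (metis imageE)
    then show "\<theta> (x \<otimes>\<^bsub>K\<^esub> y) = \<theta> x \<otimes>\<^bsub>L\<^esub> \<theta> y"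
      using \<theta>[of "a \<otimes>\<^bsub>A\<^esub> b"] \<theta> by simp
  qed
  moreover have "bij_betw \<theta> (carrier K) (carrier L)"
  proof (rule bij_betw_imageI)
    show "inj_on \<theta> (carrier K)"
      using eq \<theta> by (auto simp: inj_on_def simp flip: f(2))
    show "\<theta> ` carrier K = carrier L"
      using \<theta> by (force simp: image_image simp flip: f(2) g(2))
  qed
  ultimately show ?thesis using that[of \<theta>] \<theta> by (simp add: iso_def)
qed

section \<open>Commutators modulo the centre\<close>

context group
begin

lemma commutator_mult_center_left:
  assumes z: "z \<in> group_center G" and x: "x \<in> carrier G" and y: "y \<in> carrier G"
  shows "group_commutator G (z \<otimes> x) y = group_commutator G x y"
proof -
  have zc: "z \<in> carrier G" using z by (rule center_closed)
  have "group_commutator G (z \<otimes> x) y = inv x \<otimes> inv z \<otimes> (inv y \<otimes> z) \<otimes> x \<otimes> y"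
    using zc x y by (simp add: group_commutator_def free_simps)
  also have "inv y \<otimes> z = z \<otimes> inv y" using center_commute[OF z] y by simp
  also have "inv x \<otimes> inv z \<otimes> (z \<otimes> inv y) \<otimes> x \<otimes> y = group_commutator G x y"
    using zc x y by (simp add: group_commutator_def free_simps)
  finally show ?thesis .
qed

lemma commutator_mult_center_right:
  assumes z: "z \<in> group_center G" and x: "x \<in> carrier G" and y: "y \<in> carrier G"
  shows "group_commutator G x (z \<otimes> y) = group_commutator G x y"
  using commutator_mult_center_left[OF z y x] inv_group_commutator[of x "z \<otimes> y"]
    inv_group_commutator[of x y] x y center_closed[OF z]
  by (metis group_commutator_closed inv_inv m_closed)

text \<open>Central factors cancel from a commutator. Besides its role in isoclinism, this detects
  distinct cosets: if commutators with a fixed element differ, so do the cosets.\<close>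

lemma commutator_cong_mod_center:
  assumes "x \<in> carrier G" "y \<in> carrier G" "x' \<in> carrier G" "y' \<in> carrier G"
    and "group_center G #> x = group_center G #> x'" "group_center G #> y = group_center G #> y'"
  shows "group_commutator G x y = group_commutator G x' y'"
proof -
  have "x \<in> group_center G #> x'" "y \<in> group_center G #> y'"
    using assms rcos_self[OF _ group_center_subgroup] by metis+
  then obtain z w where "z \<in> group_center G" "x = z \<otimes> x'" "w \<in> group_center G" "y = w \<otimes> y'"
    by (auto simp: r_coset_def)
  with assms(3,4) show ?thesis
    by (simp add: commutator_mult_center_left commutator_mult_center_right center_closed)
qed

lemma group_commutator_in_derived:
  assumes "x \<in> carrier G" "y \<in> carrier G"
  shows "group_commutator G x y \<in> derived G (carrier G)"
proof -
  \<comment> \<open>Passing to inverses translates between the two commutator conventions.\<close>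
  have "group_commutator G x y = inv x \<otimes> inv y \<otimes> inv (inv x) \<otimes> inv (inv y)"
    using assms by (simp add: group_commutator_def)
  also have "\<dots> \<in> derived_set G (carrier G)"
    using assms by (intro UN_I[of "inv x"] UN_I[of "inv y"]) auto
  finally show ?thesis
    unfolding derived_def by (rule generate.incl)
qed

lemma coset_eq_iff_mem:
  assumes "subgroup H G" "x \<in> carrier G"
  shows "H #> x = H \<longleftrightarrow> x \<in> H"
  using coset_join1[OF _ _ assms(1)] coset_join2[OF _ assms(1)] assms subgroup.subset by blast

end

lemma (in group_hom) hom_group_commutator:
  "x \<in> carrier G \<Longrightarrow> y \<in> carrier G \<Longrightarrow>
    h (group_commutator G x y) = group_commutator H (h x) (h y)"
  by (simp add: group_commutator_def)

text \<open>The maps from \<open>A\<close> to the two quotients by the centre have equal kernels by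
  \<open>center\<close>, and the restrictions to the derived subgroup have equal kernels by
  \<open>der\<close>. The induced isomorphisms are compatible because commutators can be computed on
  preimages in \<open>A\<close>.\<close>

lemma isoclinic_of_common_cover:
  assumes A: "group A" and K: "group K" and L: "group L"
    and f: "f \<in> hom A K" "f ` carrier A = carrier K"
    and g: "g \<in> hom A L" "g ` carrier A = carrier L"
    and center: "\<And>a. a \<in> carrier A \<Longrightarrow> f a \<in> group_center K \<longleftrightarrow> g a \<in> group_center L"
    and der: "\<And>a. a \<in> derived A (carrier A) \<Longrightarrow> f a = \<one>\<^bsub>K\<^esub> \<longleftrightarrow> g a = \<one>\<^bsub>L\<^esub>"
  shows "isoclinic K L"
proof -
  interpret A: group A by fact
  interpret K: group K by fact
  interpret L: group L by fact
  interpret f: group_hom A K f using f by unfold_locales auto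
  interpret g: group_hom A L g using g by unfold_locales auto
  interpret ZK: normal "group_center K" K by (rule K.group_center_normal)
  interpret ZL: normal "group_center L" L by (rule L.group_center_normal)
  have fZ: "(\<lambda>a. group_center K #>\<^bsub>K\<^esub> f a) \<in> hom A (K Mod group_center K)"
    by (rule homI) (auto simp: carrier_FactGroup ZK.rcos_sum)
  have gZ: "(\<lambda>a. group_center L #>\<^bsub>L\<^esub> g a) \<in> hom A (L Mod group_center L)"
    by (rule homI) (auto simp: carrier_FactGroup ZL.rcos_sum)
  obtain \<theta> where \<theta>: "\<theta> \<in> iso (K Mod group_center K) (L Mod group_center L)"
    "\<And>a. a \<in> carrier A \<Longrightarrow> \<theta> (group_center K #>\<^bsub>K\<^esub> f a) = group_center L #>\<^bsub>L\<^esub> g a"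
  proof (rule iso_of_common_source[OF A ZK.factorgroup_is_group ZL.factorgroup_is_group fZ _ gZ])
    show "(\<lambda>a. group_center K #>\<^bsub>K\<^esub> f a) ` carrier A = carrier (K Mod group_center K)"
      by (auto simp: carrier_FactGroup simp flip: f(2))
    show "(\<lambda>a. group_center L #>\<^bsub>L\<^esub> g a) ` carrier A = carrier (L Mod group_center L)"
      by (auto simp: carrier_FactGroup simp flip: g(2))
  qed (auto simp: center K.coset_eq_iff_mem L.coset_eq_iff_mem K.group_center_subgroup
      L.group_center_subgroup)
  let ?A' = "A\<lparr>carrier := derived A (carrier A)\<rparr>"
  have dA: "derived A (carrier A) \<subseteq> carrier A"
    by (simp add: A.derived_in_carrier)
  have fd: "f ` derived A (carrier A) = derived K (carrier K)"
    using f.derived_img[of "carrier A"] f(2) by simp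
  have gd: "g ` derived A (carrier A) = derived L (carrier L)"
    using g.derived_img[of "carrier A"] g(2) by simp
  have fD: "f \<in> hom ?A' (commutator_subgroup K)" and gD: "g \<in> hom ?A' (commutator_subgroup L)"
    using dA fd gd by (auto simp: hom_def commutator_subgroup_def subset_iff)
  have grp: "group ?A'" "group (commutator_subgroup K)" "group (commutator_subgroup L)"
    unfolding commutator_subgroup_def
    by (auto intro!: A.subgroup_imp_group A.derived_is_subgroup K.subgroup_imp_group
        K.derived_is_subgroup L.subgroup_imp_group L.derived_is_subgroup)
  obtain \<phi> where \<phi>: "\<phi> \<in> iso (commutator_subgroup K) (commutator_subgroup L)"
    "\<And>a. a \<in> derived A (carrier A) \<Longrightarrow> \<phi> (f a) = g a"
    by (rule iso_of_common_source[OF grp fD _ gD])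
      (use fd gd der in \<open>auto simp: commutator_subgroup_def\<close>)
  have "\<phi> (group_commutator K a b) = group_commutator L a' b'"
    if ab: "a \<in> carrier K" "b \<in> carrier K" "a' \<in> carrier L" "b' \<in> carrier L"
      and a': "group_center L #>\<^bsub>L\<^esub> a' = \<theta> (group_center K #>\<^bsub>K\<^esub> a)"
      and b': "group_center L #>\<^bsub>L\<^esub> b' = \<theta> (group_center K #>\<^bsub>K\<^esub> b)" for a b a' b'
  proof -
    obtain x y where xy: "x \<in> carrier A" "y \<in> carrier A" "a = f x" "b = f y"
      using ab f(2) by (metis imageE)
    \<comment> \<open>The hypotheses fix \<open>a'\<close> and \<open>b'\<close> only up to the
      centre, which is all that the commutator depends on.\<close>
    have "group_commutator L a' b' = group_commutator L (g x) (g y)"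
      using a' b' xy ab \<theta>(2) by (intro L.commutator_cong_mod_center) auto
    then show ?thesis
      using \<phi>(2)[OF A.group_commutator_in_derived, of x y] xy
      by (simp add: f.hom_group_commutator g.hom_group_commutator)
  qed
  with \<theta>(1) \<phi>(1) show ?thesis unfolding isoclinic_def by blast
qed

section \<open>The integral Heisenberg group of rank four\<close>

text \<open>
  The tuple \<open>(a, b, c, d, e)\<close> stands for \<open>x\<^sub>1\<^sup>a x\<^sub>2\<^sup>b x\<^sub>3\<^sup>c x\<^sub>4\<^sup>d z\<^sup>e\<close> with \<open>z\<close> central and
  \<open>[x\<^sub>1, x\<^sub>2] = [x\<^sub>3, x\<^sub>4] = z\<close>; the term \<open>- b a' - d c'\<close> arises from moving \<open>x\<^sub>1\<close> past \<open>x\<^sub>2\<close> and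
  \<open>x\<^sub>3\<close> past \<open>x\<^sub>4\<close>.
\<close>

definition heisenberg :: "(int \<times> int \<times> int \<times> int \<times> int) monoid" where
  "heisenberg = \<lparr>carrier = UNIV,
     monoid.mult = (\<lambda>(a, b, c, d, e) (a', b', c', d', e').
       (a + a', b + b', c + c', d + d', e + e' - b * a' - d * c')),
     one = (0, 0, 0, 0, 0)\<rparr>"

lemma heisenberg_simps [simp]:
  "carrier heisenberg = UNIV"
  "\<one>\<^bsub>heisenberg\<^esub> = (0, 0, 0, 0, 0)"
  "(a, b, c, d, e) \<otimes>\<^bsub>heisenberg\<^esub> (a', b', c', d', e') =
     (a + a', b + b', c + c', d + d', e + e' - b * a' - d * c')"
  by (simp_all add: heisenberg_def)

lemma group_heisenberg: "group heisenberg"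
proof (rule groupI)
  fix x assume "x \<in> carrier heisenberg"
  obtain a b c d e where x: "x = (a, b, c, d, e)" by (cases x)
  have "(- a, - b, - c, - d, - e - a * b - c * d) \<otimes>\<^bsub>heisenberg\<^esub> x = \<one>\<^bsub>heisenberg\<^esub>"
    by (simp add: x algebra_simps)
  then show "\<exists>y\<in>carrier heisenberg. y \<otimes>\<^bsub>heisenberg\<^esub> x = \<one>\<^bsub>heisenberg\<^esub>"
    by (rule bexI) simp
qed (auto simp: algebra_simps)

lemma inv_heisenberg [simp]:
  "inv\<^bsub>heisenberg\<^esub> (a, b, c, d, e) = (- a, - b, - c, - d, - e - a * b - c * d)"
  by (rule group.inv_equality[OF group_heisenberg]) (simp_all add: algebra_simps)

text \<open>The last coordinate is the standard symplectic form on the integral lattice of rank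
  four.\<close>

lemma commutator_heisenberg [simp]:
  "group_commutator heisenberg (a, b, c, d, e) (a', b', c', d', e') =
     (0, 0, 0, 0, a * b' - a' * b + c * d' - c' * d)"
  by (simp add: group_commutator_def algebra_simps)

lemma derived_heisenberg: "derived heisenberg UNIV \<subseteq> range (\<lambda>k. (0, 0, 0, 0, k))"
proof -
  interpret group heisenberg by (rule group_heisenberg)
  have "subgroup (range (\<lambda>k. (0, 0, 0, 0, k))) heisenberg"
    by (rule subgroupI) auto
  moreover have "derived_set heisenberg UNIV \<subseteq> range (\<lambda>k. (0, 0, 0, 0, k))"
    by auto
  ultimately show ?thesis
    unfolding derived_def by (intro generate_subgroup_incl)
qed

section \<open>Groups satisfying the Heisenberg relations\<close>

context group
begin

text \<open>Conjugation by \<open>x\<close> is an endomorphism, so if it fixes \<open>y\<close> it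
  fixes all powers of \<open>y\<close>. Using this twice covers exponents of either sign without
  induction.\<close>

lemma int_pow_commute:
  assumes x: "x \<in> carrier G" and y: "y \<in> carrier G" and xy: "x \<otimes> y = y \<otimes> x"
  shows "x [^] (m::int) \<otimes> y [^] (n::int) = y [^] n \<otimes> x [^] m"
proof -
  have *: "x \<otimes> y [^] (n::int) = y [^] n \<otimes> x" if x: "x \<in> carrier G" and y: "y \<in> carrier G"
    and xy: "x \<otimes> y = y \<otimes> x" for x y n
  proof -
    have h: "(\<lambda>g. inv x \<otimes> g \<otimes> x) \<in> hom G G"
      using x by (auto simp: hom_def free_simps)
    have "inv x \<otimes> y \<otimes> x = y" using x y by (simp add: m_assoc cancel_inv_left flip: xy)
    with hom_int_pow[OF h y group_axioms group_axioms, of n]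
    have "inv x \<otimes> y [^] n \<otimes> x = y [^] n" by simp
    then have "x \<otimes> (inv x \<otimes> y [^] n \<otimes> x) = x \<otimes> y [^] n" by simp
    then show ?thesis using x y by (simp add: free_simps)
  qed
  show ?thesis
    using *[of "y [^] n" x m] *[OF x y xy] x y by simp
qed

text \<open>Conjugation by \<open>y\<close> sends \<open>x\<close> to \<open>x b\<close>, hence
  \<open>w = x^m\<close> to \<open>w b^m\<close>. Consequently conjugation by \<open>w\<close> sends
  \<open>y\<close> to \<open>y b^(-m)\<close>, hence \<open>y^n\<close> to
  \<open>y^n b^(-n m)\<close>.\<close>

lemma int_pow_commute_mod:
  assumes x: "x \<in> carrier G" and y: "y \<in> carrier G" and b: "b \<in> carrier G"
    and xy: "x \<otimes> y = y \<otimes> x \<otimes> b" and bx: "b \<otimes> x = x \<otimes> b" and yb: "b \<otimes> y = y \<otimes> b"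
  shows "y [^] (n::int) \<otimes> x [^] (m::int) = x [^] m \<otimes> y [^] n \<otimes> b [^] (- (n * m))"
proof -
  have conj: "(\<lambda>g. inv u \<otimes> g \<otimes> u) \<in> hom G G" if "u \<in> carrier G" for u
    using that by (auto simp: hom_def free_simps)
  define w where "w = x [^] m"
  have w: "w \<in> carrier G" using x by (simp add: w_def)
  have bw: "b [^] k \<otimes> w = w \<otimes> b [^] k" for k :: int
    using int_pow_commute[OF b x bx] by (simp add: w_def)
  have yk: "b [^] k \<otimes> y = y \<otimes> b [^] k" for k :: int
    using int_pow_commute[OF b y yb, of k 1] y by simp
  have "inv y \<otimes> x \<otimes> y = x \<otimes> b"
    using x y b by (simp add: m_assoc xy cancel_inv_left)
  with hom_int_pow[OF conj[OF y] x group_axioms group_axioms, of m]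
  have "inv y \<otimes> w \<otimes> y = w \<otimes> b [^] m"
    using int_pow_mult_distrib[of x b m] x b bx by (simp add: w_def)
  then have "y \<otimes> (inv y \<otimes> w \<otimes> y) = y \<otimes> (w \<otimes> b [^] m)" by simp
  then have wy: "w \<otimes> y = y \<otimes> w \<otimes> b [^] m"
    using w y b by (simp add: free_simps)
  have "inv w \<otimes> y \<otimes> w = y \<otimes> b [^] (- m)"
  proof -
    have "w \<otimes> (y \<otimes> b [^] (- m)) = w \<otimes> y \<otimes> b [^] (- m)"
      using w y b by (simp add: m_assoc)
    also have "\<dots> = y \<otimes> w"
      unfolding wy using w y b by (simp add: m_assoc int_pow_mult flip: int_pow_mult)
    finally show ?thesis using w y b by (metis int_pow_closed inv_closed inv_solve_left m_assoc m_closed)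
  qed
  with hom_int_pow[OF conj[OF w] y group_axioms group_axioms, of n]
  have "inv w \<otimes> y [^] n \<otimes> w = y [^] n \<otimes> b [^] (- (n * m))"
    using int_pow_mult_distrib[of y "b [^] (- m)" n] y b yk by (simp add: int_pow_pow mult.commute)
  then have "w \<otimes> (inv w \<otimes> y [^] n \<otimes> w) = w \<otimes> (y [^] n \<otimes> b [^] (- (n * m)))" by simp
  then show ?thesis using w y b by (simp add: free_simps flip: w_def)
qed

end

text \<open>These are the relations of \<open>heisenberg\<close> without conditions on element
  orders, so groups whose generators have different p-th powers are treated alike.\<close>

locale heisenberg_generators = group +
  fixes x1 x2 x3 x4 b
  assumes gens_closed [simp]:
      "x1 \<in> carrier G" "x2 \<in> carrier G" "x3 \<in> carrier G" "x4 \<in> carrier G" "b \<in> carrier G"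
    and b_commute: "b \<otimes> x1 = x1 \<otimes> b" "b \<otimes> x2 = x2 \<otimes> b" "b \<otimes> x3 = x3 \<otimes> b" "b \<otimes> x4 = x4 \<otimes> b"
    and pair_relations: "x1 \<otimes> x2 = x2 \<otimes> x1 \<otimes> b" "x3 \<otimes> x4 = x4 \<otimes> x3 \<otimes> b"
    and gens_commute: "x1 \<otimes> x3 = x3 \<otimes> x1" "x1 \<otimes> x4 = x4 \<otimes> x1"
      "x2 \<otimes> x3 = x3 \<otimes> x2" "x2 \<otimes> x4 = x4 \<otimes> x2"
begin

definition heis_map :: "int \<times> int \<times> int \<times> int \<times> int \<Rightarrow> 'a" where
  "heis_map = (\<lambda>(i, j, k, l, m). x1 [^] i \<otimes> x2 [^] j \<otimes> (x3 [^] k \<otimes> x4 [^] l) \<otimes> b [^] m)"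

lemma heis_map_hom: "heis_map \<in> hom heisenberg G"
proof (rule homI)
  fix g h :: "int \<times> int \<times> int \<times> int \<times> int"
  obtain i j k l m where g: "g = (i, j, k, l, m)" by (cases g)
  obtain i' j' k' l' m' where h: "h = (i', j', k', l', m')" by (cases h)
  \<comment> \<open>\<open>P\<close> and \<open>Q\<close> are the normal forms of two commuting
    rank-two Heisenberg factors sharing the central part \<open>B\<close>; multiplication is
    computed in each factor separately.\<close>
  define P where "P i j = x1 [^] i \<otimes> x2 [^] j" for i j :: int
  define Q where "Q k l = x3 [^] k \<otimes> x4 [^] l" for k l :: int
  define B where "B m = b [^] m" for m :: int
  have [simp]: "P i j \<in> carrier G" "Q i j \<in> carrier G" "B i \<in> carrier G" for i j
    by (simp_all add: P_def Q_def B_def)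
  have BB: "B m \<otimes> B n = B (m + n)" for m n
    by (simp add: B_def int_pow_mult)
  note bc = int_pow_commute[OF _ _ b_commute(1)] int_pow_commute[OF _ _ b_commute(2)]
    int_pow_commute[OF _ _ b_commute(3)] int_pow_commute[OF _ _ b_commute(4)]
  have BP: "B m \<otimes> P i j = P i j \<otimes> B m" for m i j
  proof -
    have "B m \<otimes> P i j = B m \<otimes> x1 [^] i \<otimes> x2 [^] j"
      by (simp add: P_def m_assoc)
    also have "\<dots> = x1 [^] i \<otimes> (B m \<otimes> x2 [^] j)"
      by (simp add: B_def bc m_assoc)
    finally show ?thesis by (simp add: B_def bc m_assoc P_def)
  qed
  have BQ: "B m \<otimes> Q i j = Q i j \<otimes> B m" for m i j
  proof -
    have "B m \<otimes> Q i j = B m \<otimes> x3 [^] i \<otimes> x4 [^] j"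
      by (simp add: Q_def m_assoc)
    also have "\<dots> = x3 [^] i \<otimes> (B m \<otimes> x4 [^] j)"
      by (simp add: B_def bc m_assoc)
    finally show ?thesis by (simp add: B_def bc m_assoc Q_def)
  qed
  have PP: "P i j \<otimes> P i' j' = P (i + i') (j + j') \<otimes> B (- (j * i'))" for i j i' j'
  proof -
    have "P i j \<otimes> P i' j' = x1 [^] i \<otimes> (x2 [^] j \<otimes> x1 [^] i') \<otimes> x2 [^] j'"
      by (simp add: P_def m_assoc)
    also have "x2 [^] j \<otimes> x1 [^] i' = x1 [^] i' \<otimes> x2 [^] j \<otimes> B (- (j * i'))"
      unfolding B_def by (rule int_pow_commute_mod) (simp_all add: b_commute pair_relations)
    also have "x1 [^] i \<otimes> (x1 [^] i' \<otimes> x2 [^] j \<otimes> B (- (j * i'))) \<otimes> x2 [^] j'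
        = (x1 [^] i \<otimes> x1 [^] i') \<otimes> (x2 [^] j \<otimes> (B (- (j * i')) \<otimes> x2 [^] j'))"
      by (simp add: m_assoc)
    also have "B (- (j * i')) \<otimes> x2 [^] j' = x2 [^] j' \<otimes> B (- (j * i'))"
      by (simp add: B_def bc)
    also have "x1 [^] i \<otimes> x1 [^] i' \<otimes> (x2 [^] j \<otimes> (x2 [^] j' \<otimes> B (- (j * i'))))
       = (x1 [^] i \<otimes> x1 [^] i') \<otimes> (x2 [^] j \<otimes> x2 [^] j') \<otimes> B (- (j * i'))"
      by (simp add: m_assoc)
    finally show ?thesis by (simp add: P_def int_pow_mult)
  qed
  have QQ: "Q i j \<otimes> Q i' j' = Q (i + i') (j + j') \<otimes> B (- (j * i'))" for i j i' j'
  proof -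
    have "Q i j \<otimes> Q i' j' = x3 [^] i \<otimes> (x4 [^] j \<otimes> x3 [^] i') \<otimes> x4 [^] j'"
      by (simp add: Q_def m_assoc)
    also have "x4 [^] j \<otimes> x3 [^] i' = x3 [^] i' \<otimes> x4 [^] j \<otimes> B (- (j * i'))"
      unfolding B_def by (rule int_pow_commute_mod) (simp_all add: b_commute pair_relations)
    also have "x3 [^] i \<otimes> (x3 [^] i' \<otimes> x4 [^] j \<otimes> B (- (j * i'))) \<otimes> x4 [^] j'
        = (x3 [^] i \<otimes> x3 [^] i') \<otimes> (x4 [^] j \<otimes> (B (- (j * i')) \<otimes> x4 [^] j'))"
      by (simp add: m_assoc)
    also have "B (- (j * i')) \<otimes> x4 [^] j' = x4 [^] j' \<otimes> B (- (j * i'))"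
      by (simp add: B_def bc)
    also have "x3 [^] i \<otimes> x3 [^] i' \<otimes> (x4 [^] j \<otimes> (x4 [^] j' \<otimes> B (- (j * i'))))
       = (x3 [^] i \<otimes> x3 [^] i') \<otimes> (x4 [^] j \<otimes> x4 [^] j') \<otimes> B (- (j * i'))"
      by (simp add: m_assoc)
    finally show ?thesis by (simp add: Q_def int_pow_mult)
  qed
  have QP: "Q k l \<otimes> P i j = P i j \<otimes> Q k l" for i j k l
  proof -
    note c = int_pow_commute[OF _ _ gens_commute(1)] int_pow_commute[OF _ _ gens_commute(2)]
      int_pow_commute[OF _ _ gens_commute(3)] int_pow_commute[OF _ _ gens_commute(4)]
    define u v w z where uvwz: "u = x1 [^] i" "v = x2 [^] j" "w = x3 [^] k" "z = x4 [^] l"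
    have [simp]: "u \<in> carrier G" "v \<in> carrier G" "w \<in> carrier G" "z \<in> carrier G"
      by (simp_all add: uvwz)
    have "P i j \<otimes> Q k l = u \<otimes> (v \<otimes> w) \<otimes> z"
      by (simp add: P_def Q_def m_assoc flip: uvwz)
    also have "v \<otimes> w = w \<otimes> v" unfolding uvwz by (rule c) simp_all
    also have "u \<otimes> (w \<otimes> v) \<otimes> z = (u \<otimes> w) \<otimes> (v \<otimes> z)" by (simp add: m_assoc)
    also have "u \<otimes> w = w \<otimes> u" unfolding uvwz by (rule c) simp_all
    also have "v \<otimes> z = z \<otimes> v" unfolding uvwz by (rule c) simp_all
    also have "(w \<otimes> u) \<otimes> (z \<otimes> v) = w \<otimes> (u \<otimes> z) \<otimes> v" by (simp add: m_assoc)
    also have "u \<otimes> z = z \<otimes> u" unfolding uvwz by (rule c) simp_all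
    also have "w \<otimes> (z \<otimes> u) \<otimes> v = Q k l \<otimes> P i j"
      by (simp add: P_def Q_def m_assoc flip: uvwz)
    finally show ?thesis by simp
  qed
  have "heis_map g \<otimes> heis_map h = P i j \<otimes> Q k l \<otimes> (B m \<otimes> P i' j') \<otimes> Q k' l' \<otimes> B m'"
    by (simp add: heis_map_def g h P_def Q_def B_def m_assoc)
  also have "\<dots> = P i j \<otimes> (Q k l \<otimes> P i' j') \<otimes> (B m \<otimes> Q k' l') \<otimes> B m'"
    by (simp add: BP m_assoc)
  also have "\<dots> = (P i j \<otimes> P i' j') \<otimes> (Q k l \<otimes> Q k' l') \<otimes> (B m \<otimes> B m')"
    by (simp add: BQ QP m_assoc)
  also have "\<dots> = P (i + i') (j + j') \<otimes> (B (- (j * i')) \<otimes> Q (k + k') (l + l')) \<otimes>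
      (B (- (l * k')) \<otimes> B (m + m'))"
    by (simp add: PP QQ BB m_assoc)
  also have "\<dots> = P (i + i') (j + j') \<otimes> Q (k + k') (l + l') \<otimes>
      (B (- (j * i')) \<otimes> B (- (l * k')) \<otimes> B (m + m'))"
    by (simp add: BQ m_assoc)
  also have "\<dots> = heis_map (g \<otimes>\<^bsub>heisenberg\<^esub> h)"
    by (simp add: BB g h heis_map_def P_def Q_def algebra_simps flip: B_def)
  finally show "heis_map (g \<otimes>\<^bsub>heisenberg\<^esub> h) = heis_map g \<otimes> heis_map h" ..
qed (auto simp: heis_map_def)

lemma heis_map_central: "heis_map (0, 0, 0, 0, m) = b [^] m"
  by (simp add: heis_map_def)

end

text \<open>The kernel is prescribed on the central line alone. This already decides which images
  are central, while the p-th powers of the generators stay free.\<close>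

locale heisenberg_cover = group +
  fixes p :: nat and E :: "int \<times> int \<times> int \<times> int \<times> int \<Rightarrow> 'a"
  assumes E_hom: "E \<in> hom heisenberg G"
    and E_surj: "range E = carrier G"
    and E_kernel: "E (0, 0, 0, 0, k) = \<one> \<longleftrightarrow> int p dvd k"
begin

sublocale E: group_hom heisenberg G E
  using E_hom group_heisenberg group_axioms by (simp add: group_hom_def group_hom_axioms_def)

text \<open>The symplectic form is nondegenerate modulo \<open>p\<close>: pairing with the four unit
  vectors returns each coordinate up to sign.\<close>

lemma E_center_iff:
  "E (a, b, c, d, e) \<in> group_center G \<longleftrightarrow>
     int p dvd a \<and> int p dvd b \<and> int p dvd c \<and> int p dvd d"
proof -
  have "E (a, b, c, d, e) \<in> group_center G \<longleftrightarrow>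
      (\<forall>h. group_commutator G (E (a, b, c, d, e)) (E h) = \<one>)"
    using E.hom_closed by (auto simp: center_iff_commutator simp flip: E_surj)
  also have "\<dots> \<longleftrightarrow> (\<forall>a' b' c' d'. int p dvd a * b' - a' * b + c * d' - c' * d)"
    by (simp flip: E.hom_group_commutator add: E_kernel)
  also have "\<dots> \<longleftrightarrow> int p dvd a \<and> int p dvd b \<and> int p dvd c \<and> int p dvd d"
    (is "?L \<longleftrightarrow> _")
  proof
    assume L: ?L
    have "int p dvd a" using L[rule_format, of 1 0 0 0] by simp
    moreover have "int p dvd b" using L[rule_format, of 0 1 0 0] by simp
    moreover have "int p dvd c" using L[rule_format, of 0 0 1 0] by simp
    moreover have "int p dvd d" using L[rule_format, of 0 0 0 1] by simp
    ultimately show "int p dvd a \<and> int p dvd b \<and> int p dvd c \<and> int p dvd d" by simp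
  qed (auto intro!: dvd_add dvd_diff)
  finally show ?thesis .
qed

lemma coset_eq_iff:
  "group_center G #> E (a, b, c, d, e) = group_center G #> E (a', b', c', d', e') \<longleftrightarrow>
     int p dvd a - a' \<and> int p dvd b - b' \<and> int p dvd c - c' \<and> int p dvd d - d'"
proof -
  have "group_center G #> x = group_center G #> y \<longleftrightarrow> x \<otimes> inv y \<in> group_center G"
    if "x \<in> carrier G" "y \<in> carrier G" for x y
    using subgroup.rcos_module[OF group_center_subgroup group_axioms, of y x]
      repr_independence[OF _ _ group_center_subgroup, of x y]
      rcos_self[OF _ group_center_subgroup, of x] that by metis
  from this[of "E (a, b, c, d, e)" "E (a', b', c', d', e')"] show ?thesis
    by (simp flip: E.hom_inv E.hom_mult add: E_center_iff)
qed

text \<open>The first four coordinates modulo \<open>p\<close> parametrise the cosets; the fifth is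
  absorbed by the centre and is set to 0.\<close>

lemma card_center_quotient:
  assumes p: "p > 0"
  shows "card (carrier (G Mod group_center G)) = p ^ 4"
proof -
  let ?I = "{0..<int p}"
  let ?f = "\<lambda>(a, b, c, d). group_center G #> E (a, b, c, d, 0)"
  note eq = int_eq_of_dvd_diff[where n = "int p"]
  have "inj_on ?f (?I \<times> ?I \<times> ?I \<times> ?I)"
  proof (rule inj_onI)
    fix u v assume "u \<in> ?I \<times> ?I \<times> ?I \<times> ?I" "v \<in> ?I \<times> ?I \<times> ?I \<times> ?I" "?f u = ?f v"
    moreover obtain a b c d where "u = (a, b, c, d)" by (cases u)
    moreover obtain a' b' c' d' where "v = (a', b', c', d')" by (cases v)
    ultimately show "u = v" using eq by (simp only: coset_eq_iff mem_Times_iff fst_conv snd_conv prod.case) blast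
  qed
  moreover have "?f ` (?I \<times> ?I \<times> ?I \<times> ?I) = carrier (G Mod group_center G)"
  proof
    show "?f ` (?I \<times> ?I \<times> ?I \<times> ?I) \<subseteq> carrier (G Mod group_center G)"
      by (auto simp: carrier_FactGroup)
    show "carrier (G Mod group_center G) \<subseteq> ?f ` (?I \<times> ?I \<times> ?I \<times> ?I)"
    proof
      fix C assume "C \<in> carrier (G Mod group_center G)"
      then obtain a b c d e where C: "C = group_center G #> E (a, b, c, d, e)"
        by (auto simp: carrier_FactGroup simp flip: E_surj)
      have "C = ?f (a mod int p, b mod int p, c mod int p, d mod int p)"
        unfolding C by (simp add: coset_eq_iff mod_eq_dvd_iff[symmetric])
      moreover have "(a mod int p, b mod int p, c mod int p, d mod int p) \<in> ?I \<times> ?I \<times> ?I \<times> ?I"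
        using p by simp
      ultimately show "C \<in> ?f ` (?I \<times> ?I \<times> ?I \<times> ?I)" by (rule image_eqI)
    qed
  qed
  ultimately have "bij_betw ?f (?I \<times> ?I \<times> ?I \<times> ?I) (carrier (G Mod group_center G))"
    by (rule bij_betw_imageI)
  from bij_betw_same_card[OF this] show ?thesis by (simp add: card_cartesian_product power4_eq_xxxx)
qed

lemma heisenberg_cover_class_two: "class_two_group G"
proof
  fix x y assume "x \<in> carrier G" "y \<in> carrier G"
  then obtain g h where gh: "x = E g" "y = E h" by (metis E_surj imageE)
  obtain k where "group_commutator heisenberg g h = (0, 0, 0, 0, k)"
    by (cases g; cases h) simp
  then show "group_commutator G x y \<in> group_center G"
    using E.hom_group_commutator[of g h] E_center_iff[of 0 0 0 0 k] by (simp add: gh)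
qed

end

text \<open>Centrality of an image and the kernel on the derived subgroup of
  \<open>heisenberg\<close> are both expressed through divisibility by \<open>p\<close>, with no
  reference to the cover.\<close>

lemma isoclinic_heisenberg_covers:
  assumes "heisenberg_cover G p E" "heisenberg_cover H p F"
  shows "isoclinic G H"
proof -
  interpret G: heisenberg_cover G p E by fact
  interpret H: heisenberg_cover H p F by fact
  show ?thesis
  proof (rule isoclinic_of_common_cover[OF group_heisenberg G.group_axioms H.group_axioms])
    show "E h \<in> group_center G \<longleftrightarrow> F h \<in> group_center H" for h
      by (cases h) (simp add: G.E_center_iff H.E_center_iff)
    show "E h = \<one>\<^bsub>G\<^esub> \<longleftrightarrow> F h = \<one>\<^bsub>H\<^esub>" if "h \<in> derived heisenberg (carrier heisenberg)" for h
      using that derived_heisenberg by (auto simp: G.E_kernel H.E_kernel)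
  qed (use G.E_surj H.E_surj G.E_hom H.E_hom in simp_all)
qed

section \<open>The presented extraspecial group\<close>

definition word_class :: "'g word set \<Rightarrow> 'g word \<Rightarrow> 'g word set" where
  "word_class R w = word_rel R `` {w}"

lemma carrier_presented_group: "carrier (presented_group R) = range (word_class R)"
  by (auto simp: presented_group_def quotient_def word_class_def)

lemma word_class_closed [simp]: "word_class R w \<in> carrier (presented_group R)"
  by (simp add: carrier_presented_group)

lemma word_class_append:
  "word_class R (u @ v) = word_class R u \<otimes>\<^bsub>presented_group R\<^esub> word_class R v"
  by (simp add: word_class_def presented_group_mult)

lemma word_class_Nil: "word_class R [] = \<one>\<^bsub>presented_group R\<^esub>"
  by (simp add: word_class_def presented_group_def)

lemma word_class_inv_word: "word_class R (inv_word w) = inv\<^bsub>presented_group R\<^esub> word_class R w"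
proof -
  interpret group "presented_group R" by (rule presented_group_is_group)
  have "word_class R (inv_word w) \<otimes>\<^bsub>presented_group R\<^esub> word_class R w = \<one>\<^bsub>presented_group R\<^esub>"
    using word_cong_inv_left[of R w]
    by (simp flip: word_class_append word_class_Nil) (simp add: word_class_def word_class_eq_iff)
  then show ?thesis by (simp add: inv_equality)
qed

lemma word_class_comm_word:
  "word_class R (comm_word u v) = group_commutator (presented_group R) (word_class R u) (word_class R v)"
proof -
  interpret group "presented_group R" by (rule presented_group_is_group)
  show ?thesis
    by (simp add: comm_word_def group_commutator_def word_class_append word_class_inv_word m_assoc)
qed

lemma word_class_pow_word:
  "word_class R (pow_word w n) = word_class R w [^]\<^bsub>presented_group R\<^esub> n"
proof -
  interpret group "presented_group R" by (rule presented_group_is_group)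
  show ?thesis
  proof (induction n)
    case (Suc n)
    have "pow_word w (Suc n) = w @ pow_word w n" by (simp add: pow_word_def)
    then show ?case
      using Suc nat_pow_Suc2[of "word_class R w" n] by (simp add: word_class_append)
  qed (simp add: pow_word_def word_class_Nil)
qed

lemma word_class_relator: "r \<in> R \<Longrightarrow> word_class R r = \<one>\<^bsub>presented_group R\<^esub>"
  by (simp add: word_class_def word_class_eq_iff word_cong.relator flip: word_class_Nil)

lemma word_class_letter:
  "word_class R [(x, b)] =
    (if b then word_class R (gen_word x) else inv\<^bsub>presented_group R\<^esub> word_class R (gen_word x))"
  using word_class_inv_word[of R "gen_word x"] by (simp add: gen_word_def inv_word_def)

lemma presented_group_induct:
  assumes sub: "subgroup H (presented_group R)" and gens: "\<And>x. word_class R (gen_word x) \<in> H"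
  shows "H = carrier (presented_group R)"
proof
  interpret group "presented_group R" by (rule presented_group_is_group)
  interpret H: subgroup H "presented_group R" by (rule sub)
  show "H \<subseteq> carrier (presented_group R)" by (rule H.subset)
  have "word_class R w \<in> H" for w
  proof (induction w)
    case (Cons a w)
    have "word_class R [a] \<in> H"
      using gens by (cases a) (simp add: word_class_letter)
    with Cons show ?case
      using word_class_append[of R "[a]" w] by simp
  qed (simp add: word_class_Nil)
  then show "carrier (presented_group R) \<subseteq> H"
    by (auto simp: carrier_presented_group)
qed

text \<open>
  Evaluating words in the Heisenberg group modulo \<open>p\<close> shows that \<open>\<beta>\<close> does not collapse in the
  presented group.
\<close>

primrec eval_letter :: "phi5_gen \<Rightarrow> int \<times> int \<times> int \<times> int \<times> int" where
  "eval_letter Alpha1 = (1, 0, 0, 0, 0)"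
| "eval_letter Alpha2 = (0, 1, 0, 0, 0)"
| "eval_letter Alpha3 = (0, 0, 1, 0, 0)"
| "eval_letter Alpha4 = (0, 0, 0, 1, 0)"
| "eval_letter Beta = (0, 0, 0, 0, 1)"

primrec eval_word :: "phi5_gen word \<Rightarrow> int \<times> int \<times> int \<times> int \<times> int" where
  "eval_word [] = \<one>\<^bsub>heisenberg\<^esub>"
| "eval_word (l # w) =
     (if snd l then eval_letter (fst l) else inv\<^bsub>heisenberg\<^esub> eval_letter (fst l))
       \<otimes>\<^bsub>heisenberg\<^esub> eval_word w"

lemma eval_word_append: "eval_word (u @ v) = eval_word u \<otimes>\<^bsub>heisenberg\<^esub> eval_word v"
proof -
  interpret group heisenberg by (rule group_heisenberg)
  show ?thesis by (induction u) (simp_all add: m_assoc del: heisenberg_simps(2,3))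
qed

text \<open>The congruence subgroup modulo \<open>p\<close>; its quotient stands in for the
  Heisenberg group over the field with \<open>p\<close> elements.\<close>

definition heisenberg_multiples :: "nat \<Rightarrow> (int \<times> int \<times> int \<times> int \<times> int) set" where
  "heisenberg_multiples p = {(a, b, c, d, e). int p dvd a \<and> int p dvd b \<and> int p dvd c \<and> int p dvd d \<and> int p dvd e}"

lemma normal_heisenberg_multiples: "heisenberg_multiples p \<lhd> heisenberg"
proof -
  interpret group heisenberg by (rule group_heisenberg)
  have "subgroup (heisenberg_multiples p) heisenberg"
    by (rule subgroupI) (auto simp: heisenberg_multiples_def intro!: exI[of _ 0])
  moreover have "g \<otimes>\<^bsub>heisenberg\<^esub> h \<otimes>\<^bsub>heisenberg\<^esub> inv\<^bsub>heisenberg\<^esub> g \<in> heisenberg_multiples p"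
    if "h \<in> heisenberg_multiples p" for g h
    using that by (cases g; cases h) (auto simp: heisenberg_multiples_def algebra_simps dvd_add dvd_diff)
  ultimately show ?thesis by (simp add: normal_inv_iff)
qed

text \<open>For powers of one generator the correction terms \<open>b a'\<close> and
  \<open>d c'\<close> vanish, so powers are taken coordinatewise.\<close>

lemma eval_pow_gen: "eval_word (pow_word (gen_word x) n) \<in> heisenberg_multiples n"
proof -
  have "eval_word (pow_word (gen_word x) n) =
      (case eval_letter x of (a, b, c, d, e) \<Rightarrow> (int n * a, int n * b, int n * c, int n * d, int n * e))"
    by (induction n) (cases x; simp add: pow_word_def gen_word_def algebra_simps)+
  then show ?thesis by (cases "eval_letter x") (simp add: heisenberg_multiples_def)
qed

lemma eval_relator:
  assumes "r \<in> phi5_relators p"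
  shows "eval_word r \<in> heisenberg_multiples p"
proof -
  consider x where "r = pow_word (gen_word x) p"
    | "r = comm_word (gen_word Alpha1) (gen_word Alpha2) @ inv_word (gen_word Beta)"
    | "r = comm_word (gen_word Alpha3) (gen_word Alpha4) @ inv_word (gen_word Beta)"
    | x y where "r = comm_word (gen_word x) (gen_word y)"
      "(x, y) \<notin> {(Alpha1, Alpha2), (Alpha2, Alpha1), (Alpha3, Alpha4), (Alpha4, Alpha3)}"
    using assms by (auto simp: phi5_relators_def)
  then show ?thesis
  proof cases
    case (1 x)
    then show ?thesis by (simp add: eval_pow_gen)
  next
    case (4 x y)
    then show ?thesis
      by (cases x; cases y)
        (simp_all add: heisenberg_multiples_def comm_word_def inv_word_def gen_word_def)
  qed (simp_all add: heisenberg_multiples_def comm_word_def inv_word_def gen_word_def)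
qed

lemma word_cong_eval:
  assumes "word_cong (phi5_relators p) u v"
  shows "heisenberg_multiples p #>\<^bsub>heisenberg\<^esub> eval_word u = heisenberg_multiples p #>\<^bsub>heisenberg\<^esub> eval_word v"
proof -
  interpret N: normal "heisenberg_multiples p" heisenberg by (rule normal_heisenberg_multiples)
  show ?thesis
    using assms
  proof induction
    case (append u u' v v')
    then show ?case
      using N.rcos_sum by (metis UNIV_I eval_word_append heisenberg_simps(1))
  next
    case (cancel x b)
    have "eval_word [(x, b), (x, \<not> b)] = \<one>\<^bsub>heisenberg\<^esub>"
      by (cases x; cases b) simp_all
    then show ?case by simp
  next
    case (relator r)
    then show ?case
      using N.coset_eq_iff_mem[OF N.subgroup_axioms] eval_relator N.coset_mult_one N.subset by simp
  qed auto
qed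

text \<open>The commutator relators supply the Heisenberg relations. The order of \<beta> divides
  \<open>p\<close> by its relator, and evaluation modulo \<open>p\<close> excludes order 1.\<close>

lemma heisenberg_cover_extraspecial:
  assumes p: "Factorial_Ring.prime p"
  obtains F where "heisenberg_cover (extraspecial_phi5 p) p F"
proof -
  let ?R = "phi5_relators p" and ?H = "extraspecial_phi5 p"
  define g where "g x = word_class ?R (gen_word x)" for x
  have H: "?H = presented_group ?R" by (simp add: extraspecial_phi5_def)
  interpret group ?H unfolding H by (rule presented_group_is_group)
  have gc: "g x \<in> carrier ?H" for x by (simp add: g_def H)
  have comm: "g x \<otimes>\<^bsub>?H\<^esub> g y = g y \<otimes>\<^bsub>?H\<^esub> g x"
    if "(x, y) \<notin> {(Alpha1, Alpha2), (Alpha2, Alpha1), (Alpha3, Alpha4), (Alpha4, Alpha3)}" for x y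
  proof -
    have "comm_word (gen_word x) (gen_word y) \<in> ?R"
      using that unfolding phi5_relators_def by blast
    from word_class_relator[OF this] have "group_commutator ?H (g x) (g y) = \<one>\<^bsub>?H\<^esub>"
      by (simp add: g_def H word_class_comm_word)
    then show ?thesis using gc by (simp add: group_commutator_eq_one_iff)
  qed
  have pair: "g x \<otimes>\<^bsub>?H\<^esub> g y = g y \<otimes>\<^bsub>?H\<^esub> g x \<otimes>\<^bsub>?H\<^esub> g Beta"
    if "(x, y) \<in> {(Alpha1, Alpha2), (Alpha3, Alpha4)}" for x y
  proof -
    have "comm_word (gen_word x) (gen_word y) @ inv_word (gen_word Beta) \<in> ?R"
      using that unfolding phi5_relators_def by blast
    from word_class_relator[OF this]
    have "group_commutator ?H (g x) (g y) \<otimes>\<^bsub>?H\<^esub> inv\<^bsub>?H\<^esub> g Beta = \<one>\<^bsub>?H\<^esub>"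
      by (simp add: g_def H word_class_comm_word word_class_inv_word word_class_append)
    then have "group_commutator ?H (g x) (g y) = g Beta"
      using gc by (simp add: mult_inv_eq_one_iff)
    then show ?thesis using swap_commutator[of "g x" "g y"] gc by simp
  qed
  interpret heisenberg_generators ?H "g Alpha1" "g Alpha2" "g Alpha3" "g Alpha4" "g Beta"
    by (intro heisenberg_generators.intro group_axioms heisenberg_generators_axioms.intro gc)
      ((rule comm, simp; fail) | (rule pair, simp; fail))+
  interpret hm: group_hom heisenberg ?H heis_map
    using heis_map_hom group_heisenberg group_axioms by (intro group_hom.intro group_hom_axioms.intro)
  have "range heis_map = carrier (presented_group ?R)"
  proof (rule presented_group_induct)
    show "subgroup (range heis_map) (presented_group ?R)"
      using hm.img_is_subgroup by (simp flip: H)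
    fix x
    have "g x = heis_map (eval_letter x)"
      using gc by (cases x) (simp_all add: heis_map_def)
    then show "word_class ?R (gen_word x) \<in> range heis_map" by (simp add: g_def)
  qed
  then have "range heis_map = carrier ?H" by (simp flip: H)
  moreover have "ord (g Beta) = p"
  proof -
    have "pow_word (gen_word Beta) p \<in> ?R"
      unfolding phi5_relators_def by blast
    from word_class_relator[OF this] have "g Beta [^]\<^bsub>?H\<^esub> p = \<one>\<^bsub>?H\<^esub>"
      by (simp add: g_def H word_class_pow_word)
    then have "ord (g Beta) dvd p" using gc by (simp add: pow_eq_id)
    moreover have "g Beta \<noteq> \<one>\<^bsub>?H\<^esub>"
    proof
      interpret N: normal "heisenberg_multiples p" heisenberg by (rule normal_heisenberg_multiples)
      assume "g Beta = \<one>\<^bsub>?H\<^esub>"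
      then have "word_cong ?R (gen_word Beta) []"
        by (simp add: g_def H word_class_def word_class_eq_iff flip: word_class_Nil)
      from word_cong_eval[OF this]
      have "eval_word (gen_word Beta) \<in> heisenberg_multiples p"
        using hm.G.coset_eq_iff_mem[OF N.subgroup_axioms] hm.G.coset_mult_one N.subset by simp
      then have "int p dvd 1" by (simp add: heisenberg_multiples_def gen_word_def)
      with p show False by (simp add: prime_nat_iff)
    qed
    ultimately show ?thesis
      using p gc by (metis ord_eq_1 prime_nat_iff)
  qed
  ultimately have "heisenberg_cover ?H p heis_map"
    by unfold_locales (auto simp: heis_map_hom heis_map_central int_pow_eq_id gc)
  then show ?thesis by (rule that)
qed

section \<open>Groups of the family have equal automorphism groups\<close>

context group
begin

lemma prime_order_subgroup:
  assumes H: "subgroup H G" and p: "Factorial_Ring.prime (card H)" and c: "c \<in> H" "c \<noteq> \<one>"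
  shows ord_prime_order_subgroup: "ord c = card H"
    and prime_order_subgroup_cyclic: "H = range (\<lambda>k::int. c [^] k)"
proof -
  interpret H: subgroup H G by (rule H)
  have cG: "c \<in> carrier G" using c(1) by simp
  have fin: "finite H" using p card.infinite[of H] by (metis not_prime_0)
  have gen: "generate G {c} \<subseteq> H"
    using generate_subgroup_incl[OF _ H, of "{c}"] c by simp
  interpret HG: group "G\<lparr>carrier := H\<rparr>" by (rule subgroup_imp_group[OF H])
  have sub: "subgroup (generate G {c}) (G\<lparr>carrier := H\<rparr>)"
    using subgroup_incl[OF generate_is_subgroup H gen] cG by simp
  have "card (generate G {c}) dvd card H"
    by (rule dvdI[where k = "card (rcosets\<^bsub>G\<lparr>carrier := H\<rparr>\<^esub> generate G {c})"])
      (use HG.lagrange[OF sub] in \<open>simp add: order_def mult.commute\<close>)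
  then have "ord c dvd card H" using generate_pow_card[OF cG] by simp
  moreover have "ord c \<noteq> 1" using cG c ord_eq_1 by blast
  ultimately show o: "ord c = card H" using p by (metis prime_nat_iff)
  have "generate G {c} = H"
    using card_subset_eq[OF fin gen] o generate_pow_card[OF cG] by simp
  then show "H = range (\<lambda>k::int. c [^] k)" using generate_pow[OF cG] by auto
qed

lemma comm_center_quotient_imp_class_two:
  assumes comm: "comm_group (G Mod group_center G)"
  shows "class_two_group G"
proof
  interpret Z: normal "group_center G" G by (rule group_center_normal)
  interpret Q: comm_group "G Mod group_center G" by (rule comm)
  fix x y assume x: "x \<in> carrier G" and y: "y \<in> carrier G"
  have "group_center G #> (x \<otimes> y) = group_center G #> (y \<otimes> x)"
    using Q.m_comm[of "group_center G #> x" "group_center G #> y"] x y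
    by (simp add: carrier_FactGroup Z.rcos_sum)
  then have "x \<otimes> y \<in> group_center G #> (y \<otimes> x)"
    using rcos_self[OF _ group_center_subgroup, of "x \<otimes> y"] x y by simp
  then obtain z where z: "z \<in> group_center G" "x \<otimes> y = z \<otimes> (y \<otimes> x)"
    by (auto simp: r_coset_def)
  have "y \<otimes> x \<otimes> group_commutator G x y = y \<otimes> x \<otimes> z"
    using swap_commutator[OF x y] z center_commute[OF z(1), of "y \<otimes> x"] x y by simp
  then show "group_commutator G x y \<in> group_center G"
    using z x y center_closed[OF z(1)] by simp
qed

lemma auto_hom:
  assumes "\<phi> \<in> auto G"
  shows "group_hom G G \<phi>"
  using assms group_axioms by (simp add: auto_def group_hom_def group_hom_axioms_def)

end

context class_two_group
begin

lemma comm_center_quotient: "comm_group (G Mod group_center G)"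
proof -
  interpret Z: normal "group_center G" G by (rule group_center_normal)
  show ?thesis
  proof (rule group.group_comm_groupI[OF Z.factorgroup_is_group])
    fix A B assume "A \<in> carrier (G Mod group_center G)" "B \<in> carrier (G Mod group_center G)"
    then obtain x y where xy: "x \<in> carrier G" "y \<in> carrier G"
      "A = group_center G #> x" "B = group_center G #> y"
      by (auto simp: carrier_FactGroup)
    define c where "c = group_commutator G x y"
    have c: "c \<in> group_center G" "c \<in> carrier G" using xy by (simp_all add: c_def commutator_central)
    have "group_center G #> (x \<otimes> y) = group_center G #> (c \<otimes> (y \<otimes> x))"
      using swap_commutator[of x y] xy center_commute[OF c(1), of "y \<otimes> x"] by (simp add: c_def)
    also have "\<dots> = group_center G #> c #> (y \<otimes> x)"
      using xy c by (simp add: coset_mult_assoc Z.subset)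
    also have "\<dots> = group_center G #> (y \<otimes> x)"
      using c coset_eq_iff_mem[OF group_center_subgroup c(2)] by simp
    finally show "A \<otimes>\<^bsub>G Mod group_center G\<^esub> B = B \<otimes>\<^bsub>G Mod group_center G\<^esub> A"
      using xy by (simp add: Z.rcos_sum)
  qed
qed

lemma class_preserving_imp_central: "class_preserving_auto G \<subseteq> central_auto G"
proof
  fix \<alpha> assume \<alpha>: "\<alpha> \<in> class_preserving_auto G"
  have "inv x \<otimes> \<alpha> x \<in> group_center G" if x: "x \<in> carrier G" for x
  proof -
    obtain g where g: "g \<in> carrier G" "\<alpha> x = inv g \<otimes> x \<otimes> g"
      using \<alpha> x by (auto simp: class_preserving_auto_def conjugate_in_def)
    have "inv x \<otimes> \<alpha> x = group_commutator G x g"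
      using g x conjugate_eq_commutator[of x g] by (simp add: cancel_inv_left)
    then show ?thesis using commutator_central x g by simp
  qed
  with \<alpha> show "\<alpha> \<in> central_auto G"
    by (simp add: class_preserving_auto_def central_auto_def)
qed

text \<open>A central automorphism changes elements by central factors and so fixes every
  commutator. One nontrivial commutator generates the centre, which is therefore fixed pointwise.
  For noncentral \<open>x\<close> some \<open>[x, y]\<close> generates the centre, and
  \<open>[x, y]^k = [x, y^k]\<close> makes every central factor a conjugation.\<close>

lemma central_imp_class_preserving:
  assumes p: "Factorial_Ring.prime (card (group_center G))" and nc: "\<not> comm_group G"
  shows "central_auto G \<subseteq> class_preserving_auto G"
proof
  fix \<phi> assume \<phi>: "\<phi> \<in> central_auto G"
  interpret \<phi>: group_hom G G \<phi> using \<phi> by (intro auto_hom) (simp add: central_auto_def)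
  let ?Z = "group_center G"
  note Z = group_center_subgroup
  have diff: "inv x \<otimes> \<phi> x \<in> ?Z" if "x \<in> carrier G" for x
    using \<phi> that by (simp add: central_auto_def)
  have \<phi>_eq: "\<phi> x = (inv x \<otimes> \<phi> x) \<otimes> x" if "x \<in> carrier G" for x
    using that center_commute[OF diff[OF that], of x] by (simp add: cancel_inv)
  obtain u v where uv: "u \<in> carrier G" "v \<in> carrier G" "u \<otimes> v \<noteq> v \<otimes> u"
    using nc group_comm_groupI by blast
  define c where "c = group_commutator G u v"
  have c: "c \<in> ?Z" "c \<noteq> \<one>" "c \<in> carrier G"
    using uv by (simp_all add: c_def commutator_central group_commutator_eq_one_iff)
  have "\<phi> c = group_commutator G (\<phi> u) (\<phi> v)"
    using uv by (simp add: c_def \<phi>.hom_group_commutator)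
  also have "\<dots> = c"
    using commutator_mult_center_left[OF diff[OF uv(1)] uv(1), of "\<phi> v"]
      commutator_mult_center_right[OF diff[OF uv(2)] uv(1,2)] \<phi>_eq[OF uv(1)] \<phi>_eq[OF uv(2)] uv
    by (simp add: c_def)
  finally have \<phi>c: "\<phi> c = c" .
  have "conjugate_in G x (\<phi> x)" if x: "x \<in> carrier G" for x
  proof (cases "x \<in> ?Z")
    case True
    then obtain k :: int where k: "x = c [^] k"
      using prime_order_subgroup_cyclic[OF Z p c(1,2)] by auto
    then have "\<phi> x = x" using c(3) \<phi>c by (simp add: \<phi>.hom_int_pow)
    then show ?thesis using x by (auto simp: conjugate_in_def intro!: bexI[of _ \<one>])
  next
    case False
    then obtain y where y: "y \<in> carrier G" "group_commutator G x y \<noteq> \<one>"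
      using x center_iff_commutator by blast
    obtain k :: int where k: "inv x \<otimes> \<phi> x = group_commutator G x y [^] k"
      using prime_order_subgroup_cyclic[OF Z p commutator_central[OF x y(1)] y(2)] diff[OF x] by auto
    also have "\<dots> = group_commutator G x (y [^] k)"
      using x y by (simp add: commutator_int_pow_right)
    finally have "\<phi> x = x \<otimes> group_commutator G x (y [^] k)"
      using x y by (metis cancel_inv \<phi>.hom_closed)
    then show ?thesis
      unfolding conjugate_in_def using conjugate_eq_commutator[of x "y [^] k"] x y
      by (intro bexI[of _ "y [^] k"]) simp_all
  qed
  with \<phi> show "\<phi> \<in> class_preserving_auto G"
    by (simp add: class_preserving_auto_def central_auto_def)
qed

end

text \<open>Being isomorphic to the corresponding quotient of the extraspecial group,
  \<open>G/Z(G)\<close> is abelian of order \<open>p^4\<close>; this gives class two and leaves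
  order \<open>p\<close> for the centre.\<close>

lemma in_phi5_center:
  assumes p: "Factorial_Ring.prime p" and G: "group G" "order G = p ^ 5" and phi5: "in_phi5 p G"
  shows "class_two_group G" "card (group_center G) = p"
proof -
  obtain F where "heisenberg_cover (extraspecial_phi5 p) p F"
    using heisenberg_cover_extraspecial[OF p] .
  then interpret H: heisenberg_cover "extraspecial_phi5 p" p F .
  interpret G: group G by fact
  let ?QG = "G Mod group_center G" and ?QH = "extraspecial_phi5 p Mod group_center (extraspecial_phi5 p)"
  obtain \<theta> where \<theta>: "\<theta> \<in> iso ?QG ?QH"
    using phi5 by (auto simp: in_phi5_def isoclinic_def)
  interpret Z: normal "group_center G" G by (rule G.group_center_normal)
  interpret QG: group ?QG by (rule Z.factorgroup_is_group)
  interpret QH: comm_group ?QH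
    by (rule class_two_group.comm_center_quotient[OF H.heisenberg_cover_class_two])
  have "comm_group ?QG"
  proof (rule QG.group_comm_groupI)
    fix x y assume xy: "x \<in> carrier ?QG" "y \<in> carrier ?QG"
    have h: "\<theta> \<in> hom ?QG ?QH" "inj_on \<theta> (carrier ?QG)"
      using \<theta> by (simp_all add: iso_def bij_betw_def)
    have "\<theta> x \<otimes>\<^bsub>?QH\<^esub> \<theta> y = \<theta> y \<otimes>\<^bsub>?QH\<^esub> \<theta> x"
      by (rule QH.m_comm) (use xy hom_in_carrier[OF h(1)] in blast)+
    then have "\<theta> (x \<otimes>\<^bsub>?QG\<^esub> y) = \<theta> (y \<otimes>\<^bsub>?QG\<^esub> x)"
      unfolding hom_mult[OF h(1) xy] hom_mult[OF h(1) xy(2,1)] .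
    then show "x \<otimes>\<^bsub>?QG\<^esub> y = y \<otimes>\<^bsub>?QG\<^esub> x"
      by (rule inj_onD[OF h(2)]) (intro QG.m_closed xy)+
  qed
  then show "class_two_group G" by (rule G.comm_center_quotient_imp_class_two)
  have p0: "p > 0" using p by (rule prime_gt_0_nat)
  have "card (rcosets\<^bsub>G\<^esub> group_center G) = p ^ 4"
    using bij_betw_same_card[of \<theta> "carrier ?QG" "carrier ?QH"] \<theta> H.card_center_quotient[OF p0]
    by (simp add: iso_def FactGroup_def)
  moreover have "p ^ 5 = p ^ 4 * p" by (simp add: eval_nat_numeral)
  ultimately have "p ^ 4 * card (group_center G) = p ^ 4 * p"
    using G.lagrange[OF G.group_center_subgroup] \<open>order G = p ^ 5\<close> by simp
  then show "card (group_center G) = p" using p0 by simp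
qed

section \<open>Equality of the automorphism groups forces a centre of order \<open>p\<close>\<close>

lemma inverse_mod_prime:
  assumes "Factorial_Ring.prime p" "\<not> int p dvd i"
  obtains u t where "i * u = 1 + int p * t"
proof -
  have "gcd i (int p) = 1"
    using assms prime_imp_coprime[of "int p" i] by (simp add: coprime_iff_gcd_eq_1 gcd.commute)
  then obtain u v where "u * i + v * int p = 1" using bezout_int[of i "int p"] by metis
  then have "i * u = 1 + int p * (- v)" by (simp add: algebra_simps)
  then show ?thesis by (rule that)
qed

text \<open>\<open>M\<close> is maximal among the subgroups avoiding \<open>a\<close>, a hyperplane
  complementing the line of \<open>a\<close>. If \<open>x\<close> is not in \<open>M\<close>,
  maximality gives \<open>a = x^i m\<close> with \<open>m\<close> in \<open>M\<close>. Here
  \<open>p\<close> cannot divide \<open>i\<close>, since \<open>a\<close> is not in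
  \<open>M\<close>; raising to an inverse \<open>u\<close> of \<open>i\<close> modulo
  \<open>p\<close> yields \<open>x a^(-u)\<close> in \<open>M\<close>.\<close>

lemma (in comm_group) exists_maximal_complement:
  assumes fin: "finite (carrier G)" and p: "Factorial_Ring.prime p"
    and exp: "\<And>x. x \<in> carrier G \<Longrightarrow> x [^] int p = \<one>" and a: "a \<in> carrier G" "a \<noteq> \<one>"
  obtains M where "subgroup M G" "a \<notin> M" "\<And>x. x \<in> carrier G \<Longrightarrow> \<exists>k::int. x \<otimes> a [^] k \<in> M"
proof -
  let ?S = "{M. subgroup M G \<and> a \<notin> M}"
  have "finite ?S"
    by (rule finite_subset[OF _ finite_Pow_iff[THEN iffD2, OF fin]]) (auto dest: subgroup.subset)
  moreover have "{\<one>} \<in> ?S" using a triv_subgroup by simp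
  ultimately obtain M where M: "subgroup M G" "a \<notin> M"
    and max: "\<And>M'. subgroup M' G \<Longrightarrow> a \<notin> M' \<Longrightarrow> M \<subseteq> M' \<Longrightarrow> M = M'"
    using finite_has_maximal[of ?S] by blast
  interpret M: subgroup M G by (rule M(1))
  have "\<exists>k::int. x \<otimes> a [^] k \<in> M" if x: "x \<in> carrier G" for x
  proof (cases "x \<in> M")
    case True
    then have "x \<otimes> a [^] (0::int) \<in> M" using x by simp
    then show ?thesis by blast
  next
    case False
    let ?M' = "generate G {x} <#> M"
    have sub: "subgroup ?M' G"
      using x by (intro mult_subgroups generate_is_subgroup M(1)) simp
    have "M \<subseteq> ?M'"
    proof
      fix m assume "m \<in> M"
      then have "\<one> \<otimes> m \<in> ?M'" unfolding set_mult_def using generate.one by blast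
      then show "m \<in> ?M'" using \<open>m \<in> M\<close> by simp
    qed
    moreover have "x \<otimes> \<one> \<in> ?M'"
      unfolding set_mult_def using generate.incl[of x "{x}" G] M.one_closed by blast
    then have "x \<in> ?M'" using x by simp
    ultimately have "a \<in> ?M'" using max[OF sub] False by blast
    then obtain i :: int and m where im: "m \<in> M" "a = x [^] i \<otimes> m"
      unfolding set_mult_def generate_pow[OF x] by blast
    have "\<not> int p dvd i"
    proof
      assume "int p dvd i"
      then obtain t where "i = int p * t" ..
      then have "x [^] i = \<one>" using exp[OF x] x by (simp flip: int_pow_pow)
      with im M show False by simp
    qed
    with p obtain u t where t: "i * u = 1 + int p * t"
      by (rule inverse_mod_prime)
    have "a [^] u = x [^] (i * u) \<otimes> m [^] u"
      using x im by (simp add: int_pow_distrib int_pow_pow)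
    also have "x [^] (i * u) = x"
      using x exp[OF x] by (simp add: t int_pow_mult flip: int_pow_pow)
    finally have "x \<otimes> a [^] (- u) = x \<otimes> inv (x \<otimes> m [^] u)"
      using a(1) by (simp add: int_pow_neg)
    also have "\<dots> = inv (m [^] u)"
      using x im by (simp add: inv_mult cancel_inv)
    finally have "x \<otimes> a [^] (- u) = inv (m [^] u)" .
    moreover have "inv (m [^] u) \<in> M"
      using subgroup_int_pow_closed[OF M(1) im(1)] by simp
    ultimately show ?thesis by metis
  qed
  with M show ?thesis using that by blast
qed

text \<open>A linear functional with value 1 at \<open>a\<close>, given by integers modulo
  \<open>p\<close>: \<chi> is the exponent for which \<open>x\<close> and \<open>a^\<chi>(x)\<close>
  agree modulo \<open>M\<close>.\<close>

lemma (in comm_group) exists_character_mod_prime: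
  assumes fin: "finite (carrier G)" and p: "Factorial_Ring.prime p"
    and exp: "\<And>x. x \<in> carrier G \<Longrightarrow> x [^] int p = \<one>" and a: "a \<in> carrier G" "a \<noteq> \<one>"
  obtains \<chi> :: "'a \<Rightarrow> int" where
    "\<And>x y. x \<in> carrier G \<Longrightarrow> y \<in> carrier G \<Longrightarrow> int p dvd \<chi> (x \<otimes> y) - (\<chi> x + \<chi> y)"
    "int p dvd \<chi> a - 1"
proof -
  obtain M where M: "subgroup M G" "a \<notin> M" "\<And>x. x \<in> carrier G \<Longrightarrow> \<exists>k::int. x \<otimes> a [^] k \<in> M"
    using exists_maximal_complement[OF fin p exp a] by metis
  then obtain k :: "'a \<Rightarrow> int" where k: "\<And>x. x \<in> carrier G \<Longrightarrow> x \<otimes> a [^] k x \<in> M"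
    by metis
  interpret M: subgroup M G by (rule M(1))
  \<comment> \<open>Otherwise \<open>a\<close> would be a power of \<open>a^m\<close> and lie in
    \<open>M\<close>; so exponents are determined modulo \<open>p\<close>.\<close>
  have dvd: "int p dvd m" if m: "a [^] m \<in> M" for m :: int
  proof (rule ccontr)
    assume "\<not> int p dvd m"
    with p obtain u t where t: "m * u = 1 + int p * t"
      by (rule inverse_mod_prime)
    have "(a [^] m) [^] u = a"
      using a exp[OF a(1)] by (simp add: int_pow_pow t int_pow_mult flip: int_pow_pow[of a "int p"])
    with subgroup_int_pow_closed[OF M(1) m, of u] M(2) show False by simp
  qed
  show ?thesis
  proof (rule that[of "\<lambda>x. - k x"])
    fix x y assume xy: "x \<in> carrier G" "y \<in> carrier G"
    have "(x \<otimes> a [^] k x) \<otimes> (y \<otimes> a [^] k y) \<otimes> inv (x \<otimes> y \<otimes> a [^] k (x \<otimes> y)) \<in> M"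
      using xy k by simp
    also have "(x \<otimes> a [^] k x) \<otimes> (y \<otimes> a [^] k y) = a [^] k x \<otimes> a [^] k y \<otimes> (x \<otimes> y)"
      using xy a by (simp add: m_ac)
    also have "x \<otimes> y \<otimes> a [^] k (x \<otimes> y) = a [^] k (x \<otimes> y) \<otimes> (x \<otimes> y)"
      using xy a by (simp add: m_comm)
    also have "a [^] k x \<otimes> a [^] k y \<otimes> (x \<otimes> y) \<otimes> inv (a [^] k (x \<otimes> y) \<otimes> (x \<otimes> y))
        = a [^] k x \<otimes> a [^] k y \<otimes> inv (a [^] k (x \<otimes> y))"
      using xy a by (simp add: free_simps)
    also have "\<dots> = a [^] (k x + k y - k (x \<otimes> y))"
      using xy a by (simp add: int_pow_diff int_pow_mult)
    finally show "int p dvd - k (x \<otimes> y) - (- k x + - k y)"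
      using dvd by (simp add: algebra_simps)
  next
    have "a [^] (1 + k a) \<in> M" using k[OF a(1)] a by (simp add: int_pow_mult)
    then have "int p dvd 1 + k a" using dvd by simp
    then have "int p dvd - (1 + k a)" by (rule dvd_minus_iff[THEN iffD2])
    also have "- (1 + k a) = - k a - 1" by simp
    finally show "int p dvd - k a - 1" .
  qed
qed

section \<open>Automorphisms forced to be central or class preserving\<close>

lemma (in group) finite_injective_auto:
  assumes fin: "finite (carrier G)" and f: "f \<in> hom G G"
    and ker: "\<And>x. x \<in> carrier G \<Longrightarrow> f x = \<one> \<Longrightarrow> x = \<one>"
  shows "restrict f (carrier G) \<in> auto G"
proof -
  interpret f: group_hom G G f using f by unfold_locales
  have "inj_on f (carrier G)" using ker f.inj_on_one_iff by blast
  moreover have "f ` carrier G = carrier G"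
    using calculation f.hom_closed by (intro endo_inj_surj[OF fin]) auto
  ultimately have "bij_betw (restrict f (carrier G)) (carrier G) (carrier G)"
    by (auto simp: bij_betw_def inj_on_def)
  then show ?thesis
    using f by (auto simp: auto_def Bij_def hom_def)
qed

lemma (in group) class_two_if_class_preserving_central:
  assumes fin: "finite (carrier G)" and sub: "class_preserving_auto G \<subseteq> central_auto G"
  shows "class_two_group G"
proof
  fix x g assume x: "x \<in> carrier G" and g: "g \<in> carrier G"
  let ?\<alpha> = "\<lambda>x. inv g \<otimes> x \<otimes> g"
  have "restrict ?\<alpha> (carrier G) \<in> auto G"
  proof (rule finite_injective_auto[OF fin])
    show "?\<alpha> \<in> hom G G" using g by (auto simp: hom_def free_simps)
    fix y assume y: "y \<in> carrier G" "?\<alpha> y = \<one>"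
    have "y = g \<otimes> ?\<alpha> y \<otimes> inv g" using y(1) g by (simp add: free_simps)
    also have "\<dots> = \<one>" unfolding y(2) using g by simp
    finally show "y = \<one>" .
  qed
  then have "restrict ?\<alpha> (carrier G) \<in> class_preserving_auto G"
    using g by (auto simp: class_preserving_auto_def conjugate_in_def)
  with sub have "restrict ?\<alpha> (carrier G) \<in> central_auto G" ..
  then have "inv x \<otimes> ?\<alpha> x \<in> group_center G"
    using x by (auto simp: central_auto_def)
  then show "group_commutator G x g \<in> group_center G"
    using x g by (simp add: group_commutator_def m_assoc)
qed

text \<open>The map \<open>x \<mapsto> x f(x)\<close> is multiplicative because \<open>f\<close> has
  central values. An element of its kernel equals \<open>inv (f y)\<close> and is central, which is
  why \<open>ker\<close> is stated on the centre. Class preservation then makes \<open>f x\<close> a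
  commutator with \<open>x\<close>. The lemma serves both the p-th power map and maps factoring
  through \<open>G/Z(G)\<close>.\<close>

lemma (in class_two_group) central_hom_is_commutator:
  assumes fin: "finite (carrier G)" and sub: "central_auto G \<subseteq> class_preserving_auto G"
    and f: "f \<in> hom G G" "\<And>x. x \<in> carrier G \<Longrightarrow> f x \<in> group_center G"
    and ker: "\<And>z. z \<in> group_center G \<Longrightarrow> z \<otimes> f z = \<one> \<Longrightarrow> z = \<one>"
    and x: "x \<in> carrier G"
  obtains g where "g \<in> carrier G" "f x = group_commutator G x g"
proof -
  have fc: "f y \<in> carrier G" if "y \<in> carrier G" for y using f(2)[OF that] by (rule center_closed)
  let ?\<alpha> = "\<lambda>x. x \<otimes> f x"
  have "restrict ?\<alpha> (carrier G) \<in> auto G"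
  proof (rule finite_injective_auto[OF fin])
    show "?\<alpha> \<in> hom G G"
    proof (rule homI)
      fix u v assume uv: "u \<in> carrier G" "v \<in> carrier G"
      have "u \<otimes> v \<otimes> f (u \<otimes> v) = u \<otimes> (v \<otimes> f u) \<otimes> f v"
        using uv fc f(1) by (simp add: hom_mult m_assoc)
      also have "v \<otimes> f u = f u \<otimes> v" using center_commute[OF f(2)] uv by simp
      finally show "u \<otimes> v \<otimes> f (u \<otimes> v) = u \<otimes> f u \<otimes> (v \<otimes> f v)"
        using uv fc by (simp add: m_assoc)
    qed (simp add: fc)
    fix y assume y: "y \<in> carrier G" "y \<otimes> f y = \<one>"
    then have "y = inv (f y)" using fc by (metis inv_equality inv_inv)
    then have "y \<in> group_center G"
      using subgroup.m_inv_closed[OF group_center_subgroup f(2)[OF y(1)]] by simp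
    then show "y = \<one>" using ker y(2) by blast
  qed
  moreover have "inv y \<otimes> (y \<otimes> f y) \<in> group_center G" if "y \<in> carrier G" for y
    using that fc f(2) by (simp add: cancel_inv_left)
  ultimately have "restrict ?\<alpha> (carrier G) \<in> class_preserving_auto G"
    using sub by (auto simp: central_auto_def)
  then obtain g where g: "g \<in> carrier G" "x \<otimes> f x = inv g \<otimes> x \<otimes> g"
    using x by (auto simp: class_preserving_auto_def conjugate_in_def)
  then have "f x = group_commutator G x g"
    using conjugate_eq_commutator[OF x g(1)] x fc by simp
  with g that show ?thesis by blast
qed

text \<open>
  If \<open>g\<^sup>p\<close> is not central, some \<open>c = [g, h]\<close> has order at least \<open>p\<^sup>2\<close>; then the \<open>g\<^sup>i h\<^sup>j\<close> fill \<open>p\<^sup>4\<close>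
  cosets of a centre of order at least \<open>p\<^sup>2\<close>, which is too much for a group of order \<open>p\<^sup>5\<close>.
\<close>

lemma (in class_two_group) pow_prime_central:
  assumes p: "Factorial_Ring.prime p" and ord5: "order G = p ^ 5" and g: "g \<in> carrier G"
  shows "g [^] p \<in> group_center G"
proof (rule ccontr)
  assume "g [^] p \<notin> group_center G"
  then obtain h where h: "h \<in> carrier G" "group_commutator G (g [^] p) h \<noteq> \<one>"
    using g center_iff_commutator[of "g [^] p"] by auto
  define c where "c = group_commutator G g h"
  have c: "c \<in> group_center G" "c \<in> carrier G" using g h by (simp_all add: c_def commutator_central)
  have p1: "p > 1" using p by (rule prime_gt_1_nat)
  have fin: "finite (carrier G)" using ord5 p1 order_gt_0_iff_finite by simp
  note Z = group_center_subgroup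
  have "c [^] p \<noteq> \<one>"
    using h(2) commutator_int_pow_left[OF g h(1), of "int p"] by (simp add: c_def int_pow_int)
  then have "\<not> ord c dvd p" using c by (simp add: pow_eq_id)
  moreover obtain k where k: "ord c = p ^ k"
    using ord_dvd_group_order[OF c(2)] ord5 divides_primepow_nat[OF p] by auto
  ultimately have "k \<ge> 2"
    by (metis dvd_refl less_2_cases not_le one_dvd power_0 power_one_right One_nat_def)
  define q where "q = p ^ 2"
  have qc: "q dvd ord c" using \<open>k \<ge> 2\<close> by (simp add: q_def k le_imp_power_dvd)
  have q_dvd: "int q dvd i - j" if "c [^] j = c [^] i" for i j :: int
    using that qc c by (simp add: int_pow_eq) (meson dvd_trans of_nat_dvd_iff)
  let ?I = "{0..<int q}" and ?f = "\<lambda>(i, j). group_center G #> (g [^] i \<otimes> h [^] j)"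
  have "inj_on ?f (?I \<times> ?I)"
  proof (rule inj_onI, clarify)
    fix i j i' j' assume ij: "i \<in> ?I" "j \<in> ?I" "i' \<in> ?I" "j' \<in> ?I"
      and eq: "group_center G #> (g [^] i \<otimes> h [^] j) = group_center G #> (g [^] i' \<otimes> h [^] j')"
    \<comment> \<open>The commutator with \<open>h\<close> isolates \<open>c^i\<close> and the one
      with \<open>g\<close> isolates \<open>c^j\<close>, so the coset determines both exponents
      modulo \<open>p^2\<close>.\<close>
    have "group_commutator G (g [^] i \<otimes> h [^] j) h = group_commutator G (g [^] i' \<otimes> h [^] j') h"
      by (rule commutator_cong_mod_center) (use g h eq in simp_all)
    then have "c [^] i = c [^] i'"
      using g h by (simp add: commutator_mult_left commutator_int_pow_left commutator_self c_def)
    moreover have "group_commutator G g (g [^] i \<otimes> h [^] j) = group_commutator G g (g [^] i' \<otimes> h [^] j')"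
      by (rule commutator_cong_mod_center) (use g h eq in simp_all)
    then have "c [^] j = c [^] j'"
      using g h by (simp add: commutator_mult_right commutator_int_pow_right commutator_self c_def)
    ultimately show "i = i' \<and> j = j'"
      using ij q_dvd int_eq_of_dvd_diff[of _ "int q"] by metis
  qed
  moreover have "?f ` (?I \<times> ?I) \<subseteq> rcosets (group_center G)"
    using g h by (auto intro!: rcosetsI subgroup.subset[OF Z])
  moreover have "finite (rcosets (group_center G))"
    using fin by (simp add: RCOSETS_def)
  ultimately have "card (?I \<times> ?I) \<le> card (rcosets (group_center G))"
    by (metis card_image card_mono)
  then have "q * q \<le> card (rcosets (group_center G))" by (simp add: card_cartesian_product)
  moreover have "q \<le> card (group_center G)"
  proof -
    have "generate G {c} \<subseteq> group_center G"
      using generate_subgroup_incl[OF _ Z, of "{c}"] c by simp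
    then have "card (generate G {c}) \<le> card (group_center G)"
      using fin finite_subset[OF subgroup.subset[OF Z]] by (intro card_mono) auto
    then have "ord c \<le> card (group_center G)" using generate_pow_card[OF c(2)] by simp
    moreover have "q \<le> ord c" using qc k p1 by (intro dvd_imp_le) auto
    ultimately show ?thesis by simp
  qed
  ultimately have "q * q * q \<le> p ^ 5"
    using mult_le_mono lagrange[OF Z] ord5 by metis
  moreover have "q * q * q = p ^ 5 * p" by (simp add: q_def eval_nat_numeral)
  ultimately show False using p1 by simp
qed

locale central_class_preserving_group = class_two_group +
  fixes p :: nat
  assumes prime_p: "Factorial_Ring.prime p" and odd_p: "odd p"
    and order_p5: "order G = p ^ 5"
    and central_class_preserving: "central_auto G \<subseteq> class_preserving_auto G"
begin

lemma p_gt_1: "p > 1"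
  using prime_p by (rule prime_gt_1_nat)

lemma finite_carrier: "finite (carrier G)"
  using order_p5 p_gt_1 order_gt_0_iff_finite by simp

lemma commutator_pow_p:
  assumes "x \<in> carrier G" "y \<in> carrier G"
  shows "group_commutator G x y [^] p = \<one>"
  using commutator_int_pow_left[of x y "int p"] assms
    commutator_center_left[OF pow_prime_central[OF prime_p order_p5]]
  by (simp add: int_pow_int)

text \<open>
  Since \<open>p\<close> is odd, \<open>x \<mapsto> x\<^sup>p\<close> is a homomorphism into the centre, so \<open>x \<mapsto> x\<^sup>1\<^sup>+\<^sup>p\<close> is a central
  automorphism; being class preserving, it fixes the centre.
\<close>

lemma center_exponent:
  assumes z: "z \<in> group_center G"
  shows "z [^] p = \<one>"
proof -
  \<comment> \<open>Since \<open>p\<close> is odd, \<open>p\<close> divides the binomial exponent in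
    \<open>power_mult_class_two\<close>, and the commutator term disappears.\<close>
  have half: "p * (p - 1) div 2 = p * ((p - 1) div 2)"
    using odd_p div_mult_swap[of 2 "p - 1" p] by simp
  have "group_commutator G y x [^] (p * (p - 1) div 2) = \<one>"
    if "x \<in> carrier G" "y \<in> carrier G" for x y
    unfolding half using that commutator_pow_p by (simp flip: nat_pow_pow)
  then have "(\<lambda>x. x [^] p) \<in> hom G G"
    by (intro homI) (simp_all add: power_mult_class_two)
  then obtain g where "g \<in> carrier G" "z [^] p = group_commutator G z g"
  proof (rule central_hom_is_commutator[OF finite_carrier central_class_preserving])
    show "x [^] p \<in> group_center G" if "x \<in> carrier G" for x
      using pow_prime_central[OF prime_p order_p5 that] .
    show "x = \<one>" if x: "x \<in> group_center G" "x \<otimes> x [^] p = \<one>" for x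
    proof -
      have xc: "x \<in> carrier G" using x(1) by (rule center_closed)
      \<comment> \<open>The order of a kernel element divides both \<open>p + 1\<close> and
        \<open>p^5\<close>.\<close>
      then have "x [^] Suc p = \<one>" using x(2) by (metis nat_pow_Suc2)
      then have "ord x dvd Suc p" using xc pow_eq_id by blast
      moreover have "ord x dvd p ^ 5" using ord_dvd_group_order[OF xc] order_p5 by simp
      moreover have "coprime (Suc p) (p ^ 5)" by simp
      ultimately have "ord x = 1" by (metis coprime_common_divisor_nat nat_dvd_1_iff_1)
      then show "x = \<one>" using xc ord_eq_1 by blast
    qed
    show "z \<in> carrier G" using z by (rule center_closed)
  qed
  \<comment> \<open>For central \<open>z\<close> the commutator representing \<open>z^p\<close> is
    trivial.\<close>
  then show ?thesis using commutator_center_left[OF z] by simp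
qed

text \<open>
  A homomorphism \<open>f\<close> of the elementary abelian group \<open>G/Z\<close> to \<open>Z\<close> with \<open>f g = z\<close> yields the central
  automorphism \<open>x \<mapsto> x f(x)\<close>, whose class preservation at \<open>g\<close> gives \<open>z\<close> as a commutator.
\<close>

lemma center_eq_commutators:
  assumes g: "g \<in> carrier G" "g \<notin> group_center G" and z: "z \<in> group_center G"
  obtains h where "h \<in> carrier G" "z = group_commutator G g h"
proof -
  interpret Z: normal "group_center G" G by (rule group_center_normal)
  interpret Q: comm_group "G Mod group_center G" by (rule comm_center_quotient)
  have zc: "z \<in> carrier G" using z by (rule center_closed)
  have eq_iff: "group_center G #> x = group_center G \<longleftrightarrow> x \<in> group_center G"
    if "x \<in> carrier G" for x
    using coset_eq_iff_mem[OF group_center_subgroup that] .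
  have "finite (carrier (G Mod group_center G))"
    using finite_carrier by (simp add: carrier_FactGroup)
  moreover have "A [^]\<^bsub>G Mod group_center G\<^esub> int p = \<one>\<^bsub>G Mod group_center G\<^esub>"
    if A: "A \<in> carrier (G Mod group_center G)" for A
  proof -
    obtain x where "x \<in> carrier G" "A = group_center G #> x"
      using A by (auto simp: carrier_FactGroup)
    then show ?thesis
      using pow_prime_central[OF prime_p order_p5, of x]
      by (simp add: Z.FactGroup_pow int_pow_int eq_iff)
  qed
  moreover have "group_center G #> g \<in> carrier (G Mod group_center G)"
    "group_center G #> g \<noteq> \<one>\<^bsub>G Mod group_center G\<^esub>"
    using g by (auto simp: carrier_FactGroup eq_iff)
  ultimately obtain \<chi> :: "'a set \<Rightarrow> int" where
    \<chi>: "\<And>A B. A \<in> carrier (G Mod group_center G) \<Longrightarrow> B \<in> carrier (G Mod group_center G) \<Longrightarrow>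
      int p dvd \<chi> (A \<otimes>\<^bsub>G Mod group_center G\<^esub> B) - (\<chi> A + \<chi> B)"
    and \<chi>g: "int p dvd \<chi> (group_center G #> g) - 1"
    using Q.exists_character_mod_prime[OF _ prime_p] by metis
  \<comment> \<open>Since \<open>z^p = 1\<close>, a functional known modulo \<open>p\<close> can
    serve as an exponent of \<open>z\<close>.\<close>
  have zp: "z [^] i = z [^] j" if "int p dvd i - j" for i j :: int
  proof -
    have "ord z dvd p" using center_exponent[OF z] zc by (simp add: pow_eq_id)
    then have "int (ord z) dvd i - j" using that by (meson dvd_trans of_nat_dvd_iff)
    then show ?thesis using int_pow_eq[OF zc, of j i] by simp
  qed
  define f where "f x = z [^] \<chi> (group_center G #> x)" for x
  have "f \<in> hom G G"
  proof (rule homI)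
    fix x y assume "x \<in> carrier G" "y \<in> carrier G"
    then have "f (x \<otimes> y) = z [^] (\<chi> (group_center G #> x) + \<chi> (group_center G #> y))"
      unfolding f_def using \<chi>[of "group_center G #> x" "group_center G #> y"]
      by (intro zp) (auto simp: carrier_FactGroup Z.rcos_sum)
    then show "f (x \<otimes> y) = f x \<otimes> f y" using zc by (simp add: f_def int_pow_mult)
  qed (simp add: f_def zc)
  moreover have "f x \<in> group_center G" for x
    unfolding f_def by (rule subgroup_int_pow_closed[OF group_center_subgroup z])
  moreover have "x = \<one>" if x: "x \<in> group_center G" "x \<otimes> f x = \<one>" for x
  proof -
    have xc: "x \<in> carrier G" using x(1) by (rule center_closed)
    \<comment> \<open>\<open>f\<close> factors through the quotient and is thus trivial on the
      centre, so the kernel condition holds.\<close>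
    have "group_center G #> x = group_center G #> \<one>"
      using eq_iff[OF xc] eq_iff[OF one_closed] x(1) subgroup.one_closed[OF group_center_subgroup] by simp
    then have "f x = f \<one>" by (simp add: f_def)
    also have "\<dots> = \<one>"
      using hom_one[OF \<open>f \<in> hom G G\<close> group_axioms group_axioms] .
    finally show "x = \<one>" using x(2) xc by simp
  qed
  ultimately obtain h where "h \<in> carrier G" "f g = group_commutator G g h"
    using central_hom_is_commutator[OF finite_carrier central_class_preserving] g(1) by metis
  moreover have "f g = z" using zp[OF \<chi>g] zc by (simp add: f_def)
  ultimately show ?thesis using that by blast
qed

text \<open>
  For a larger centre, \<open>x\<close>, \<open>y\<close>, \<open>w\<close> span the three-dimensional space \<open>G/Z\<close>. Modulo the subgroup \<open>N\<close>
  generated by \<open>[x, y]\<close> the commutator is an alternating form there, hence has a nonzero radical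
  vector \<open>u\<close>; but the commutators of \<open>u\<close> exhaust the centre.
\<close>

lemma card_center_le:
  assumes nc: "\<not> comm_group G"
  shows "card (group_center G) \<le> p"
proof (rule ccontr)
  assume big: "\<not> card (group_center G) \<le> p"
  note Z = group_center_subgroup
  let ?Z = "group_center G" and ?c = "group_commutator G"
  obtain x y where x: "x \<in> carrier G" and y: "y \<in> carrier G" and xy: "?c x y \<noteq> \<one>"
    using nc group_comm_groupI by (metis group_commutator_eq_one_iff)
  have xZ: "x \<notin> ?Z" using xy y center_iff_commutator x by blast
  define n where "n = ?c x y"
  have n: "n \<in> ?Z" "n \<in> carrier G" "n \<noteq> \<one>" using x y xy by (simp_all add: n_def commutator_central)
  have ord_p: "ord u = p" if "u \<in> ?Z" "u \<noteq> \<one>" for u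
  proof -
    have "ord u dvd p" using center_exponent[OF that(1)] center_closed[OF that(1)] by (simp add: pow_eq_id)
    moreover have "ord u \<noteq> 1" using that center_closed ord_eq_1 by blast
    ultimately show ?thesis using prime_p by (metis prime_nat_iff)
  qed
  define N where "N = range (\<lambda>k::int. n [^] k)"
  have N: "N = generate G {n}" using generate_pow[OF n(2)] by (auto simp: N_def)
  have Nsub: "subgroup N G" unfolding N using n(2) by (intro generate_is_subgroup) simp
  have "card N = p" unfolding N using generate_pow_card[OF n(2)] ord_p n by simp
  have "finite N" using \<open>card N = p\<close> p_gt_1 by (metis card.infinite not_less_zero)
  then have "\<not> ?Z \<subseteq> N" using big \<open>card N = p\<close> card_mono by blast
  then obtain e where e: "e \<in> ?Z" "e \<notin> N" by blast
  obtain w where w: "w \<in> carrier G" "e = ?c x w" using center_eq_commutators[OF x xZ e(1)] .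
  have ec: "e \<in> carrier G" using e(1) by (rule center_closed)
  have n_eq: "int p dvd i - j" if "n [^] j = n [^] i" for i j :: int
    using that n ord_p by (simp add: int_pow_eq)
  have e_N: "int p dvd i" if i: "e [^] i \<in> N" for i :: int
  proof (rule ccontr)
    assume "\<not> int p dvd i"
    with prime_p obtain u t where t: "i * u = 1 + int p * t"
      by (rule inverse_mod_prime)
    have "e [^] int p = \<one>" using center_exponent[OF e(1)] by (simp add: int_pow_int)
    then have "(e [^] i) [^] u = e"
      using ec by (simp add: int_pow_pow t int_pow_mult flip: int_pow_pow[of e "int p"])
    with subgroup_int_pow_closed[OF Nsub i, of u] e(2) show False by simp
  qed
  let ?I = "{0..<int p}" and ?w = "\<lambda>(i::int) (j::int) (k::int). x [^] i \<otimes> y [^] j \<otimes> w [^] k"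
  let ?f = "\<lambda>(i, j, k). ?Z #> ?w i j k"
  have wc: "?w i j k \<in> carrier G" for i j k using x y w by simp
  \<comment> \<open>The commutator with \<open>x\<close> yields \<open>j\<close> and
    \<open>k\<close>, because \<open>n\<close> and \<open>e\<close> are independent; the commutator
    with \<open>y\<close> then yields \<open>i\<close>.\<close>
  have cx: "?c x (?w i j k) = n [^] j \<otimes> e [^] k" for i j k
    using x y w by (simp add: commutator_mult_right commutator_int_pow_right commutator_self n_def)
  have cy: "?c (?w i j k) y = n [^] i \<otimes> ?c w y [^] k" for i j k
    using x y w by (simp add: commutator_mult_left commutator_int_pow_left commutator_self n_def)
  have "inj_on ?f (?I \<times> ?I \<times> ?I)"
  proof (rule inj_onI)
    fix s t assume st: "s \<in> ?I \<times> ?I \<times> ?I" "t \<in> ?I \<times> ?I \<times> ?I" "?f s = ?f t"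
    obtain i j k where s: "s = (i, j, k)" by (cases s)
    obtain i' j' k' where t: "t = (i', j', k')" by (cases t)
    have I: "i \<in> ?I" "j \<in> ?I" "k \<in> ?I" "i' \<in> ?I" "j' \<in> ?I" "k' \<in> ?I"
      and eq: "?Z #> ?w i j k = ?Z #> ?w i' j' k'"
      using st by (simp_all add: s t)
    have "?c x (?w i j k) = ?c x (?w i' j' k')"
      by (rule commutator_cong_mod_center) (use x wc eq in simp_all)
    then have *: "n [^] j \<otimes> e [^] k = n [^] j' \<otimes> e [^] k'" by (simp only: cx)
    have "e [^] (k - k') = n [^] (j' - j)"
    proof -
      have "e [^] (k - k') = inv (n [^] j) \<otimes> (n [^] j \<otimes> e [^] k) \<otimes> inv (e [^] k')"
        using n ec by (simp add: int_pow_diff cancel_inv_left)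
      also have "\<dots> = inv (n [^] j) \<otimes> n [^] j'"
        unfolding * using n ec by (simp add: m_assoc)
      also have "\<dots> = n [^] (- j) \<otimes> n [^] j'" using n by (simp add: int_pow_neg)
      also have "\<dots> = n [^] (j' - j)" using int_pow_mult[OF n(2), of "- j" j'] by simp
      finally show ?thesis .
    qed
    then have "int p dvd k - k'" by (intro e_N) (simp add: N_def)
    then have k: "k = k'" using I int_eq_of_dvd_diff by blast
    with * have "n [^] j = n [^] j'" using n ec by simp
    then have j: "j = j'" using I int_eq_of_dvd_diff n_eq by metis
    have "?c (?w i j k) y = ?c (?w i' j' k') y"
      by (rule commutator_cong_mod_center) (use y wc eq in simp_all)
    then have "n [^] i = n [^] i'" using n y w by (simp add: cy k)
    then have "i = i'" using I int_eq_of_dvd_diff n_eq by metis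
    with j k show "s = t" by (simp add: s t)
  qed
  then have card_f: "card (?f ` (?I \<times> ?I \<times> ?I)) = p ^ 3"
    by (simp add: card_image card_cartesian_product eval_nat_numeral)
  have f_sub: "?f ` (?I \<times> ?I \<times> ?I) \<subseteq> rcosets ?Z"
    using wc by (auto intro!: rcosetsI subgroup.subset[OF Z])
  have fin: "finite (rcosets ?Z)" using finite_carrier by (simp add: RCOSETS_def)
  obtain m where m: "card ?Z = p ^ m"
    using lagrange[OF Z] order_p5 divides_primepow_nat[OF prime_p] by (metis dvd_triv_right)
  have "m \<ge> 2"
  proof (rule ccontr)
    assume "\<not> m \<ge> 2"
    then have "p ^ m \<le> p ^ 1" using p_gt_1 by (intro power_increasing) auto
    with big m show False by simp
  qed
  \<comment> \<open>A centre of order at least \<open>p^2\<close> has at most \<open>p^3\<close>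
    cosets, so the \<open>p^3\<close> cosets found above are all of them.\<close>
  then have "p ^ 2 \<le> card ?Z" using m p_gt_1 by simp
  then have "card (rcosets ?Z) * p ^ 2 \<le> card (rcosets ?Z) * card ?Z" by (rule mult_le_mono2)
  also have "\<dots> = p ^ 3 * p ^ 2" using lagrange[OF Z] order_p5 by (simp flip: power_add)
  finally have "card (rcosets ?Z) * p ^ 2 \<le> p ^ 3 * p ^ 2" .
  then have "card (rcosets ?Z) \<le> p ^ 3"
    by (rule mult_right_le_imp_le) (use p_gt_1 in simp)
  then have "card (rcosets ?Z) \<le> card (?f ` (?I \<times> ?I \<times> ?I))" by (simp only: card_f)
  with f_sub fin have f_all: "?f ` (?I \<times> ?I \<times> ?I) = rcosets ?Z" by (intro card_seteq)
  have repr: "\<exists>i j k. ?Z #> v = ?Z #> ?w i j k" if "v \<in> carrier G" for v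
  proof -
    have "?Z #> v \<in> ?f ` (?I \<times> ?I \<times> ?I)"
      unfolding f_all using that subgroup.subset[OF Z] by (intro rcosetsI)
    then show ?thesis by auto
  qed
  have comm_repr: "\<exists>i j k. ?c u v = ?c u (?w i j k)" if uv: "u \<in> carrier G" "v \<in> carrier G" for u v
  proof -
    obtain i j k where "?Z #> v = ?Z #> ?w i j k" using repr[OF uv(2)] by blast
    then have "?c u v = ?c u (?w i j k)"
      using uv wc by (intro commutator_cong_mod_center) simp_all
    then show ?thesis by blast
  qed
  \<comment> \<open>Commutators with \<open>x\<close> exhaust the centre, so \<open>[y, w]\<close>
    also has the form given by \<open>cx\<close> and is a product of powers of \<open>n\<close> and
    \<open>e\<close>.\<close>
  obtain g where g: "g \<in> carrier G" "?c y w = ?c x g"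
    using center_eq_commutators[OF x xZ commutator_central[OF y w(1)]] .
  obtain j0 k0 :: int where jk: "?c y w = n [^] j0 \<otimes> e [^] k0"
    using comm_repr[OF x g(1)] unfolding g(2) cx by blast
  \<comment> \<open>As \<open>[x, w] = e\<close>, the factor \<open>x^(-k0)\<close> cancels the
    \<open>e\<close>-part of \<open>[y, w]\<close>; this is the radical vector modulo
    \<open>N\<close>.\<close>
  define u where "u = y \<otimes> x [^] (- k0)"
  have u: "u \<in> carrier G" using x y by (simp add: u_def)
  have "?c u w \<in> N"
  proof -
    have "?c u w = n [^] j0 \<otimes> e [^] k0 \<otimes> e [^] (- k0)"
      using x y w jk by (simp add: u_def commutator_mult_left commutator_int_pow_left)
    also have "\<dots> = n [^] j0" using n ec by (simp add: m_assoc int_pow_neg)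
    finally show ?thesis by (simp add: N_def)
  qed
  moreover have "?c u x \<in> N"
  proof -
    have "?c u x = inv n"
      using x y n by (simp add: u_def commutator_mult_left commutator_int_pow_left commutator_self
          n_def inv_group_commutator)
    then show ?thesis using subgroup.m_inv_closed[OF Nsub] N n(2) generate.incl[of n "{n}" G] by simp
  qed
  moreover have "?c u y \<in> N"
    using x y n by (simp add: u_def commutator_mult_left commutator_int_pow_left commutator_self
        N_def flip: n_def)
  ultimately have "?c u (?w i j k) \<in> N" for i j k
    using x y w u by (simp add: commutator_mult_right commutator_int_pow_right
        subgroup.m_closed[OF Nsub] subgroup_int_pow_closed[OF Nsub])
  then have uN: "?c u v \<in> N" if "v \<in> carrier G" for v
    using comm_repr[OF u that] by metis
  have "?c x u = n"
    using x y n by (simp add: u_def commutator_mult_right commutator_int_pow_right commutator_self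
        n_def)
  then have "u \<notin> ?Z" using commutator_center_right[of u x] x n(3) by auto
  then obtain v where "v \<in> carrier G" "e = ?c u v" using center_eq_commutators[OF u _ e(1)] by metis
  with uN e(2) show False by simp
qed

lemma card_center:
  assumes nc: "\<not> comm_group G"
  shows "card (group_center G) = p"
proof -
  obtain m where m: "card (group_center G) = p ^ m"
    using lagrange[OF group_center_subgroup] order_p5 divides_primepow_nat[OF prime_p]
    by (metis dvd_triv_right)
  obtain x y where xy: "x \<in> carrier G" "y \<in> carrier G" "group_commutator G x y \<noteq> \<one>"
    using nc group_comm_groupI by (metis group_commutator_eq_one_iff)
  have "card (group_center G) \<noteq> 1"
  proof
    assume "card (group_center G) = 1"
    then have "group_center G = {\<one>}"
      using subgroup.one_closed[OF group_center_subgroup] by (metis card_1_singletonE singletonD)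
    with xy commutator_central show False by blast
  qed
  then have "m \<noteq> 0" using m by (metis power_0)
  moreover have "p ^ m \<le> p ^ 1" using card_center_le[OF nc] m by simp
  then have "m \<le> 1" using p_gt_1 power_increasing_iff by blast
  ultimately show ?thesis using m by (simp add: le_Suc_eq)
qed

end

text \<open>
  The generators are a symplectic basis of \<open>G/Z\<close> for the commutator form.
\<close>

lemma (in class_two_group) heisenberg_cover_prime_center:
  assumes p: "Factorial_Ring.prime p" and ord5: "order G = p ^ 5" and nc: "\<not> comm_group G"
    and card_Z: "card (group_center G) = p"
  obtains E where "heisenberg_cover G p E"
proof -
  let ?Z = "group_center G" and ?c = "group_commutator G"
  note Z = group_center_subgroup
  have p1: "p > 1" using p by (rule prime_gt_1_nat)
  have prime_Z: "Factorial_Ring.prime (card ?Z)" using p card_Z by simp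
  obtain x1 x2 where x1: "x1 \<in> carrier G" and x2: "x2 \<in> carrier G" and b1: "?c x1 x2 \<noteq> \<one>"
    using nc group_comm_groupI by (metis group_commutator_eq_one_iff)
  define b where "b = ?c x1 x2"
  have b: "b \<in> ?Z" "b \<in> carrier G" "b \<noteq> \<one>" using x1 x2 b1 by (simp_all add: b_def commutator_central)
  have ord_b: "ord b = p" using ord_prime_order_subgroup[OF Z prime_Z b(1,3)] card_Z by simp
  have powZ: "\<exists>k::int. z = u [^] k" if "u \<in> ?Z" "u \<noteq> \<one>" "z \<in> ?Z" for u z
    using prime_order_subgroup_cyclic[OF Z prime_Z that(1,2)] that(3) by auto
  have b_eq: "b [^] i = b [^] j \<longleftrightarrow> int p dvd j - i" for i j :: int
    using b ord_b by (simp add: int_pow_eq)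
  have b_mod: "b [^] (k mod int p) = b [^] k" for k :: int
    by (simp add: b_eq mod_eq_dvd_iff[symmetric])
  have c21: "?c x2 x1 = b [^] (-1::int)"
    using x1 x2 b by (simp add: b_def inv_group_commutator int_pow_neg)
  let ?I = "{0..<int p}"
  have mod_I: "k mod int p \<in> ?I" for k using p1 by simp
  \<comment> \<open>Orthogonal projection away from the hyperbolic plane of \<open>x1\<close> and
    \<open>x2\<close>. The exponents are kept in \<open>?I\<close> for the counting below.\<close>
  have adjust: "\<exists>i \<in> ?I. \<exists>j \<in> ?I. \<exists>g'. g' \<in> carrier G \<and> g = x1 [^] i \<otimes> x2 [^] j \<otimes> g' \<and>
      ?c x1 g' = \<one> \<and> ?c x2 g' = \<one>" if g: "g \<in> carrier G" for g
  proof -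
    obtain m :: int where m: "?c x1 g = b [^] m" using powZ[OF b(1,3) commutator_central[OF x1 g]] by blast
    obtain n :: int where n: "?c x2 g = b [^] n" using powZ[OF b(1,3) commutator_central[OF x2 g]] by blast
    \<comment> \<open>The sign of \<open>i\<close> comes from
      \<open>[x2, x1] = b^(-1)\<close>.\<close>
    define i j where "i = (- n) mod int p" and "j = m mod int p"
    define h where "h = x1 [^] i \<otimes> x2 [^] j"
    have h: "h \<in> carrier G" using x1 x2 by (simp add: h_def)
    define g' where "g' = inv h \<otimes> g"
    have g': "g' \<in> carrier G" "g = h \<otimes> g'" using g h by (simp_all add: g'_def cancel_inv)
    have "?c x1 h = ?c x1 g"
      using x1 x2 b
      by (simp add: h_def commutator_mult_right commutator_int_pow_right commutator_self
          j_def b_mod m flip: b_def)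
    then have "?c x1 g \<otimes> ?c x1 g' = ?c x1 g"
      using commutator_mult_right[OF h g'(1) x1] g'(2) by simp
    then have 1: "?c x1 g' = \<one>" using x1 g g' by (simp add: r_cancel_one)
    have "?c x2 h = (b [^] (-1::int)) [^] i"
      using x1 x2 b by (simp add: h_def commutator_mult_right commutator_int_pow_right commutator_self c21)
    also have "\<dots> = b [^] (- i)" using b by (simp add: int_pow_pow)
    also have "\<dots> = ?c x2 g"
    proof -
      have "int p dvd n + i" by (simp add: i_def mod_0_imp_dvd mod_add_right_eq)
      then show ?thesis unfolding n by (simp add: b_eq)
    qed
    finally have "?c x2 g \<otimes> ?c x2 g' = ?c x2 g"
      using commutator_mult_right[OF h g'(1) x2] g'(2) by simp
    then have 2: "?c x2 g' = \<one>" using x2 g g' by (simp add: r_cancel_one)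
    show ?thesis
      using g' 1 2 mod_I unfolding h_def i_def j_def by blast
  qed
  \<comment> \<open>The subgroup generated by \<open>x1\<close>, \<open>x2\<close> and the centre
    fits into \<open>p^3\<close> products; an element outside them has a noncentral projection
    \<open>x3\<close>.\<close>
  let ?P = "(\<lambda>(i, j, k). x1 [^] i \<otimes> x2 [^] j \<otimes> b [^] k) ` (?I \<times> ?I \<times> ?I)"
  have "card ?P \<le> card (?I \<times> ?I \<times> ?I)" by (rule card_image_le) simp
  also have "\<dots> = p ^ 3" by (simp add: card_cartesian_product eval_nat_numeral)
  also have "\<dots> < card (carrier G)"
    using ord5 p1 by (simp add: order_def power_strict_increasing)
  finally have "\<not> carrier G \<subseteq> ?P" by (metis card_mono finite_SigmaI finite_atLeastLessThan_int finite_imageI not_le)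
  then obtain g where g: "g \<in> carrier G" "g \<notin> ?P" by blast
  obtain i j x3 where ij: "i \<in> ?I" "j \<in> ?I" and x3: "x3 \<in> carrier G" "g = x1 [^] i \<otimes> x2 [^] j \<otimes> x3"
    and c13: "?c x1 x3 = \<one>" and c23: "?c x2 x3 = \<one>"
    using adjust[OF g(1)] by blast
  have "x3 \<notin> ?Z"
  proof
    assume "x3 \<in> ?Z"
    then obtain k :: int where "x3 = b [^] k" using powZ[OF b(1,3)] by blast
    then have "g = (\<lambda>(i, j, k). x1 [^] i \<otimes> x2 [^] j \<otimes> b [^] k) (i, j, k mod int p)"
      using x3(2) by (simp add: b_mod)
    moreover have "(i, j, k mod int p) \<in> ?I \<times> ?I \<times> ?I" using ij mod_I by blast
    ultimately show False using g(2) by blast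
  qed
  then obtain h where h: "h \<in> carrier G" "?c x3 h \<noteq> \<one>"
    using x3(1) center_iff_commutator by blast
  obtain i j h' where h': "h' \<in> carrier G" "h = x1 [^] (i::int) \<otimes> x2 [^] (j::int) \<otimes> h'"
    and c1h: "?c x1 h' = \<one>" and c2h: "?c x2 h' = \<one>"
    using adjust[OF h(1)] by blast
  have c31: "?c x3 x1 = \<one>" and c32: "?c x3 x2 = \<one>"
    using c13 c23 x1 x2 x3 inv_group_commutator by (metis inv_one)+
  have "?c x3 h' \<noteq> \<one>"
    using h h' x1 x2 x3 c31 c32 by (auto simp: commutator_mult_right commutator_int_pow_right)
  then obtain k :: int where k: "b = ?c x3 h' [^] k"
    using powZ[OF commutator_central[OF x3(1) h'(1)]] b(1) by blast
  \<comment> \<open>The power \<open>k\<close> rescales the partner of \<open>x3\<close> so that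
    both pairs have the same commutator \<open>b\<close>.\<close>
  define x4 where "x4 = h' [^] k"
  have x4: "x4 \<in> carrier G" using h' by (simp add: x4_def)
  have c34: "?c x3 x4 = b" and c14: "?c x1 x4 = \<one>" and c24: "?c x2 x4 = \<one>"
    using x1 x2 x3 h' c1h c2h by (simp_all add: x4_def commutator_int_pow_right flip: k)
  interpret heisenberg_generators G x1 x2 x3 x4 b
  proof
    show "x1 \<otimes> x2 = x2 \<otimes> x1 \<otimes> b" using swap_commutator[OF x1 x2] by (simp add: b_def)
    show "x3 \<otimes> x4 = x4 \<otimes> x3 \<otimes> b" using swap_commutator[OF x3(1) x4] c34 by simp
  qed (use x1 x2 x3 x4 b center_commute[OF b(1)] c13 c14 c23 c24
      in \<open>simp_all add: group_commutator_eq_one_iff\<close>)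
  interpret E: group_hom heisenberg G heis_map
    using heis_map_hom group_heisenberg group_axioms by (intro group_hom.intro group_hom_axioms.intro)
  have commE: "?c (heis_map (i, j, k, l, m)) (heis_map (i', j', k', l', m')) =
      b [^] (i * j' - i' * j + k * l' - k' * l)" for i j k l m i' j' k' l' m'
    using E.hom_group_commutator[of "(i, j, k, l, m)" "(i', j', k', l', m')"]
    by (simp add: heis_map_central)
  \<comment> \<open>The box has \<open>p^5\<close> elements, as many as \<open>G\<close>, so
    injectivity on it gives surjectivity.\<close>
  have "inj_on heis_map (?I \<times> ?I \<times> ?I \<times> ?I \<times> ?I)"
  proof (rule inj_onI)
    fix u v assume uv: "u \<in> ?I \<times> ?I \<times> ?I \<times> ?I \<times> ?I" "v \<in> ?I \<times> ?I \<times> ?I \<times> ?I \<times> ?I"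
      "heis_map u = heis_map v"
    obtain i j k l m where u: "u = (i, j, k, l, m)" by (cases u)
    obtain i' j' k' l' m' where v: "v = (i', j', k', l', m')" by (cases v)
    have I: "i \<in> ?I" "j \<in> ?I" "k \<in> ?I" "l \<in> ?I" "m \<in> ?I"
        "i' \<in> ?I" "j' \<in> ?I" "k' \<in> ?I" "l' \<in> ?I" "m' \<in> ?I"
      and eq: "heis_map (i, j, k, l, m) = heis_map (i', j', k', l', m')"
      using uv by (simp_all add: u v)
    \<comment> \<open>Equal images have equal commutators with every image; unit vectors for
      \<open>(r, t, s, v)\<close> then separate the first four coordinates.\<close>
    have *: "int p dvd (i * t - r * j + k * v - s * l) - (i' * t - r * j' + k' * v - s * l')" for r s t v
      using commE[of i j k l m r t s v 0] commE[of i' j' k' l' m' r t s v 0] eq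
      by (simp add: b_eq)
    have "i = i'"
      using *[where t = 1 and r = 0 and v = 0 and s = 0] I
      by (intro int_eq_of_dvd_diff[of _ "int p"]) simp_all
    moreover have "j' = j"
      using *[where t = 0 and r = 1 and v = 0 and s = 0] I
      by (intro int_eq_of_dvd_diff[of _ "int p"]) simp_all
    moreover have "k = k'"
      using *[where t = 0 and r = 0 and v = 1 and s = 0] I
      by (intro int_eq_of_dvd_diff[of _ "int p"]) simp_all
    moreover have "l' = l"
      using *[where t = 0 and r = 0 and v = 0 and s = 1] I
      by (intro int_eq_of_dvd_diff[of _ "int p"]) simp_all
    moreover from calculation have "b [^] m' = b [^] m" using eq x1 x2 x3 x4 b by (simp add: heis_map_def)
    then have "m = m'" using I by (intro int_eq_of_dvd_diff[of _ "int p"]) (simp_all add: b_eq)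
    ultimately show "u = v" by (simp add: u v)
  qed
  then have "card (heis_map ` (?I \<times> ?I \<times> ?I \<times> ?I \<times> ?I)) = card (carrier G)"
    using ord5 by (simp add: card_image card_cartesian_product order_def eval_nat_numeral)
  moreover have "finite (carrier G)" using ord5 p1 order_gt_0_iff_finite by simp
  moreover have "range heis_map \<subseteq> carrier G" using E.hom_closed by auto
  ultimately have "heis_map ` (?I \<times> ?I \<times> ?I \<times> ?I \<times> ?I) = carrier G"
    by (intro card_subset_eq) auto
  with \<open>range heis_map \<subseteq> carrier G\<close> have "range heis_map = carrier G" by blast
  then have "heisenberg_cover G p heis_map"
    using b_eq[of 0] by unfold_locales (auto simp: heis_map_hom heis_map_central eq_commute[of \<one>])
  then show ?thesis by (rule that)
qed

theorem theorem5p1: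
  fixes G :: "('a, 'b) monoid_scheme" and p :: nat
  assumes "Factorial_Ring.prime p" and "odd p"
    and "group G" and "\<not> comm_group G" and "order G = p ^ 5"
  shows "class_preserving_auto G = central_auto G \<longleftrightarrow> in_phi5 p G"
proof
  interpret group G by fact
  assume eq: "class_preserving_auto G = central_auto G"
  have "finite (carrier G)"
    using assms(1,5) order_gt_0_iff_finite by (simp add: prime_gt_0_nat)
  then interpret class_two_group G
    using eq by (intro class_two_if_class_preserving_central) auto
  interpret central_class_preserving_group G p
    using assms eq by unfold_locales auto
  obtain E where "heisenberg_cover G p E"
    using heisenberg_cover_prime_center[OF assms(1,5,4) card_center[OF assms(4)]] .
  moreover obtain F where "heisenberg_cover (extraspecial_phi5 p) p F"
    using heisenberg_cover_extraspecial[OF assms(1)] .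
  ultimately show "in_phi5 p G"
    using isoclinic_heisenberg_covers assms(3) by (simp add: in_phi5_def)
next
  assume phi5: "in_phi5 p G"
  note G = in_phi5_center[OF assms(1,3,5) phi5]
  interpret class_two_group G by (rule G(1))
  show "class_preserving_auto G = central_auto G"
    using class_preserving_imp_central central_imp_class_preserving G(2) assms(1,4) by blast
qed

end
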